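(* Let $a(s)=a_3s^3+a_2s^2+a_1s+a_0$ and $b(s)=b_3s^3+b_2s^2+b_1s+b_0$ be coprime real polynomials, with $a_3,b_3$ not both zero and $b_i>0$ for at least one $i\in\{0,1,2,3\}$, and let $Z=a/b$. Let the polynomials $\alpha,\beta,\kappa,c_0,c_1,c_2,d_0,d_1,d_2,\gamma_1,\gamma_2,\gamma_3,\lambda_1\in\mathbb{R}[u]$, the number $F_0=F_0(a,b)$, the conditions (C5), (E5) on a real number $\tilde x$, and the network classes be as defined in the context. If $Z$ is the impedance of a network from $\mathcal{N}_{14}$, then there exists $\tilde x\ge0$ such that conditions (C5) and (E5) hold. In this case, an explicit realization for $Z$ is obtained as follows. If $\tilde x\ge0$ is such that (C5) holds, then $\beta(\tilde x),d_0(\tilde x),\lambda_1(\tilde x)\ne0$, $\kappa(\tilde x),\gamma_1(\tilde x)>0$, and $Z$ is the impedance of $N_{14}$ when (all polynomials evaluated at $\tilde x$) $$R_1=\tfrac{\kappa c_0}{d_0},\quad R_2=\tfrac{\kappa\gamma_1^2}{d_0\lambda_1},\quad G_3=\tfrac{d_2\lambda_1}{\kappa^2\beta^4F_0},\quad R_4=\tfrac{\alpha}{\beta},\quad R_5=\tfrac{\kappa\tilde x}{\beta^2},\quad C_1=\tfrac{\beta^2}{\kappa},\quad L_1=\tfrac{\beta^4\kappa^2\gamma_1F_0}{\lambda_1^2},\quad L_2=\tfrac{\kappa\gamma_1}{d_0^2}.$$ In particular, if (E5)(i) (resp. (E5)(ii), (E5)(iii)) holds, then $R_5=0$ (resp.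 $R_1=0$, $G_3=0$), so this network is from class $\mathcal{N}_{30}$ (resp. $\mathcal{N}_{28}$, $\mathcal{N}_{29}$).
   Context: **Networks.** Networks are built from resistors (impedance $R$), inductors (impedance $Ls$) and capacitors (impedance $1/(Cs)$) by series connection (impedances add, written $+$) and parallel connection ($1/(Z_1\parallel Z_2)=1/Z_1+1/Z_2$). A resistor of resistance $R=0$ is a short circuit; a resistor of conductance $G=0$, written $1/G$, is an open circuit. $\mathcal{N}_{14}$ is the set of all networks of the form $$N_{14}:\quad R_4+\left[\left(R_5+\tfrac1{C_1s}\right)\parallel\left(R_1+\left(L_2s\parallel\left(R_2+\left(\tfrac1{G_3}\parallel L_1s\right)\right)\right)\right)\right]$$ with $R_1,R_4,R_5\ge0$, $R_2>0$, $G_3\ge0$, $C_1,L_1,L_2>0$. Subclasses obtained by removing one element: $\mathcal{N}_{28}$, $\mathcal{N}_{29}$, $\mathcal{N}_{30}$ are $\mathcal{N}_{14}$ with $R_1=0$, $G_3=0$, $R_5=0$ respectively. **Algebra.** $F_0(a,b)$ is the determinant of the $6\times6$ matrix with rows $(b_3,b_2,b_1,b_0,0,0)$, $(a_3,a_2,a_1,a_0,0,0)$, $(0,b_3,b_2,b_1,b_0,0)$, $(0,a_3,a_2,a_1,a_0,0)$, $(0,0,b_3,b_2,b_1,b_0)$, $(0,0,a_3,a_2,a_1,a_0)$. For polynomials $p,q$ in $s$ of degree at most $3$ (coefficients possibly polynomials in $u$), $\mathcal{B}(q,p)$ is the $3\times3$ matrix with $\frac{q(z)p(w)-p(z)q(w)}{z-w}=\sum_{i,j=1}^3\mathcal{B}_{ij}z^{i-1}w^{j-1}$.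 Define $[c_0\ c_1\ c_2](u)=[-u^2\ \ u\ \ -1]\,\mathcal{B}(a,b)$, $\alpha(u)=-a_0u^3+a_1u^2-a_2u+a_3$, $\beta(u)=-b_0u^3+b_1u^2-b_2u+b_3$, $\kappa(u)=c_0(u)u^2-c_1(u)u+c_2(u)$, $[d_0\ d_1\ d_2](u)=\beta(u)\,[-u^2\ \ u\ \ -1]\,\mathcal{B}(b,c)(u)$, where $c(s)=c_2s^3+c_1s^2+c_0s$ is viewed as a polynomial in $s$ with coefficients in $\mathbb{R}[u]$; and $\gamma_1=c_1d_0-c_0d_1$, $\gamma_2=c_2d_0-c_0d_2$, $\gamma_3=c_2d_1-c_1d_2$, $\lambda_1=d_1\gamma_1-d_0\gamma_2$. A set of real numbers "have the same sign" if all are non-negative or all are non-positive. **Conditions.** (C5) $a_i,b_i\ge0$ for $i=0,1,2,3$; $\alpha(\tilde x),\beta(\tilde x),c_0(\tilde x),c_1(\tilde x),c_2(\tilde x),d_0(\tilde x),d_1(\tilde x),d_2(\tilde x)$ and $\lambda_1(\tilde x)$ have the same sign; $\kappa(\tilde x),\gamma_2(\tilde x)\ge0$; and $F_0(a,b)>0$. (E5) (i) $\tilde x=0$; or (ii) $c_0(\tilde x)=0$; or (iii) $d_2(\tilde x)=0$. *)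

theory Defs
  imports
    "HOL-Computational_Algebra.Polynomial_Factorial"
    "Jordan_Normal_Form.Determinant"
begin

text \<open>
  An impedance is a real rational function of \<open>s\<close>, or \<open>None\<close> for the infinite impedance of an
  open circuit.  Keeping the infinite value separate avoids the convention \<open>inverse 0 = 0\<close>, under
  which an open circuit would be confused with a short circuit.
\<close>

type_synonym impedance = "real poly fract option"

definition rat_const :: "real \<Rightarrow> real poly fract" where
  "rat_const r = to_fract [:r:]"

definition rat_s :: "real poly fract" where
  "rat_s = to_fract [:0, 1:]"

fun recip :: "impedance \<Rightarrow> impedance" where
  "recip None = Some 0"
| "recip (Some z) = (if z = 0 then None else Some (inverse z))"

fun series_imp :: "impedance \<Rightarrow> impedance \<Rightarrow> impedance" where
  "series_imp (Some z1) (Some z2) = Some (z1 + z2)"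
| "series_imp _ _ = None"

definition parallel_imp :: "impedance \<Rightarrow> impedance \<Rightarrow> impedance" where
  "parallel_imp z1 z2 = recip (series_imp (recip z1) (recip z2))"

text \<open>\<open>Conductor G\<close> is the resistor of conductance \<open>G\<close>, an open circuit if \<open>G = 0\<close>.\<close>

datatype network =
    Resistor real
  | Conductor real
  | Inductor real
  | Capacitor real
  | Series network network (infixl \<open>\<oplus>\<^sub>s\<close> 65)
  | Parallel network network (infixl \<open>\<parallel>\<^sub>p\<close> 70)

primrec impedance :: "network \<Rightarrow> impedance" where
  "impedance (Resistor R) = Some (rat_const R)"
| "impedance (Conductor G) = recip (Some (rat_const G))"
| "impedance (Inductor L) = Some (rat_const L * rat_s)"
| "impedance (Capacitor C) = recip (Some (rat_const C * rat_s))"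
| "impedance (N1 \<oplus>\<^sub>s N2) = series_imp (impedance N1) (impedance N2)"
| "impedance (N1 \<parallel>\<^sub>p N2) = parallel_imp (impedance N1) (impedance N2)"

text \<open>The arguments are \<open>R\<^sub>1 R\<^sub>2 G\<^sub>3 R\<^sub>4 R\<^sub>5 C\<^sub>1 L\<^sub>1 L\<^sub>2\<close>.\<close>

definition N14 ::
  "real \<Rightarrow> real \<Rightarrow> real \<Rightarrow> real \<Rightarrow> real \<Rightarrow> real \<Rightarrow> real \<Rightarrow> real \<Rightarrow> network" where
  "N14 R1 R2 G3 R4 R5 C1 L1 L2 =
     Resistor R4 \<oplus>\<^sub>s
       ((Resistor R5 \<oplus>\<^sub>s Capacitor C1) \<parallel>\<^sub>p
        (Resistor R1 \<oplus>\<^sub>s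
          (Inductor L2 \<parallel>\<^sub>p (Resistor R2 \<oplus>\<^sub>s (Conductor G3 \<parallel>\<^sub>p Inductor L1)))))"

definition class_N14 :: "network set" where
  "class_N14 = {N14 R1 R2 G3 R4 R5 C1 L1 L2 | R1 R2 G3 R4 R5 C1 L1 L2.
     R1 \<ge> 0 \<and> R4 \<ge> 0 \<and> R5 \<ge> 0 \<and> R2 > 0 \<and> G3 \<ge> 0 \<and> C1 > 0 \<and> L1 > 0 \<and> L2 > 0}"

definition class_N28 :: "network set" where
  "class_N28 = {N14 0 R2 G3 R4 R5 C1 L1 L2 | R2 G3 R4 R5 C1 L1 L2.
     R4 \<ge> 0 \<and> R5 \<ge> 0 \<and> R2 > 0 \<and> G3 \<ge> 0 \<and> C1 > 0 \<and> L1 > 0 \<and> L2 > 0}"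

definition class_N29 :: "network set" where
  "class_N29 = {N14 R1 R2 0 R4 R5 C1 L1 L2 | R1 R2 R4 R5 C1 L1 L2.
     R1 \<ge> 0 \<and> R4 \<ge> 0 \<and> R5 \<ge> 0 \<and> R2 > 0 \<and> C1 > 0 \<and> L1 > 0 \<and> L2 > 0}"

definition class_N30 :: "network set" where
  "class_N30 = {N14 R1 R2 G3 R4 0 C1 L1 L2 | R1 R2 G3 R4 C1 L1 L2.
     R1 \<ge> 0 \<and> R4 \<ge> 0 \<and> R2 > 0 \<and> G3 \<ge> 0 \<and> C1 > 0 \<and> L1 > 0 \<and> L2 > 0}"

definition F0 :: "real poly \<Rightarrow> real poly \<Rightarrow> real" where
  "F0 p q = (let a = coeff p; b = coeff q in
     det (mat_of_rows_list 6
       [[b 3, b 2, b 1, b 0,   0,   0],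
        [a 3, a 2, a 1, a 0,   0,   0],
        [  0, b 3, b 2, b 1, b 0,   0],
        [  0, a 3, a 2, a 1, a 0,   0],
        [  0,   0, b 3, b 2, b 1, b 0],
        [  0,   0, a 3, a 2, a 1, a 0]]))"

definition lift_poly :: "'a::zero poly \<Rightarrow> 'a poly poly" where
  "lift_poly = map_poly (\<lambda>r. [:r:])"

text \<open>
  Polynomials in \<open>z\<close> and \<open>w\<close> are represented with outer variable \<open>z\<close> and inner variable \<open>w\<close>:
  \<open>lift_poly q\<close> is \<open>q(z)\<close>, \<open>[:p:]\<close> is \<open>p(w)\<close>, and \<open>[:[:0, -1:], 1:]\<close> is \<open>z - w\<close>.
  The division below is exact, as \<open>bezout_poly_mult\<close> shows.
\<close>

definition bezout_poly :: "'a::idom_divide poly \<Rightarrow> 'a poly \<Rightarrow> 'a poly poly" where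
  "bezout_poly q p =
     (lift_poly q * [:p:] - lift_poly p * [:q:]) div [:[:0, -1:], 1:]"

lemma bezout_poly_mult:
  "[:[:0, -1:], 1:] * bezout_poly q p = lift_poly q * [:p:] - lift_poly p * [:q:]"
proof -
  have lift_eval: "poly (lift_poly r) [:0, 1:] = r" for r :: "'a poly"
    by (induction r) (simp_all add: lift_poly_def map_poly_pCons)
  have "poly (lift_poly q * [:p:] - lift_poly p * [:q:]) [:0, 1:] = 0"
    by (simp add: lift_eval)
  hence "[:- [:0, 1:], 1:] dvd lift_poly q * [:p:] - lift_poly p * [:q:]"
    by (simp only: poly_eq_0_iff_dvd)
  hence "[:[:0, -1:], 1:] dvd lift_poly q * [:p:] - lift_poly p * [:q:]"
    by simp
  thus ?thesis
    unfolding bezout_poly_def by (rule dvd_mult_div_cancel)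
qed

text \<open>Rows and columns are indexed from \<open>0\<close>, so entry \<open>(i, j)\<close> belongs to \<open>z\<^sup>i w\<^sup>j\<close>.\<close>

definition bezout_mat :: "'a::idom_divide poly \<Rightarrow> 'a poly \<Rightarrow> 'a mat" where
  "bezout_mat q p = mat 3 3 (\<lambda>(i, j). coeff (coeff (bezout_poly q p) i) j)"

text \<open>
  Elements of \<open>\<real>[u]\<close> have type \<^typ>\<open>real poly\<close>; polynomials in \<open>s\<close> over \<open>\<real>[u]\<close> have type
  \<^typ>\<open>real poly poly\<close>, with outer variable \<open>s\<close>.  Thus \<open>lift_poly a\<close> is \<open>a(s)\<close> viewed over \<open>\<real>[u]\<close>.
\<close>

definition u_row :: "real poly mat" where
  "u_row = mat_of_rows_list 3 [[- ([:0, 1:]\<^sup>2), [:0, 1:], - 1]]"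

definition alpha_u :: "real poly \<Rightarrow> real poly" where
  "alpha_u a = [:coeff a 3, - coeff a 2, coeff a 1, - coeff a 0:]"

definition beta_u :: "real poly \<Rightarrow> real poly" where
  "beta_u b = [:coeff b 3, - coeff b 2, coeff b 1, - coeff b 0:]"

definition c_u :: "real poly \<Rightarrow> real poly \<Rightarrow> nat \<Rightarrow> real poly" where
  "c_u a b k = (u_row * bezout_mat (lift_poly a) (lift_poly b)) $$ (0, k)"

definition kappa_u :: "real poly \<Rightarrow> real poly \<Rightarrow> real poly" where
  "kappa_u a b = c_u a b 0 * [:0, 1:]\<^sup>2 - c_u a b 1 * [:0, 1:] + c_u a b 2"

definition c_s :: "real poly \<Rightarrow> real poly \<Rightarrow> real poly poly" where
  "c_s a b = [:0, c_u a b 0, c_u a b 1, c_u a b 2:]"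

definition d_u :: "real poly \<Rightarrow> real poly \<Rightarrow> nat \<Rightarrow> real poly" where
  "d_u a b k = beta_u b * (u_row * bezout_mat (lift_poly b) (c_s a b)) $$ (0, k)"

definition gamma1_u :: "real poly \<Rightarrow> real poly \<Rightarrow> real poly" where
  "gamma1_u a b = c_u a b 1 * d_u a b 0 - c_u a b 0 * d_u a b 1"

definition gamma2_u :: "real poly \<Rightarrow> real poly \<Rightarrow> real poly" where
  "gamma2_u a b = c_u a b 2 * d_u a b 0 - c_u a b 0 * d_u a b 2"

definition gamma3_u :: "real poly \<Rightarrow> real poly \<Rightarrow> real poly" where
  "gamma3_u a b = c_u a b 2 * d_u a b 1 - c_u a b 1 * d_u a b 2"

definition lambda1_u :: "real poly \<Rightarrow> real poly \<Rightarrow> real poly" where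
  "lambda1_u a b = d_u a b 1 * gamma1_u a b - d_u a b 0 * gamma2_u a b"

definition same_sign :: "real set \<Rightarrow> bool" where
  "same_sign X \<longleftrightarrow> (\<forall>x\<in>X. x \<ge> 0) \<or> (\<forall>x\<in>X. x \<le> 0)"

definition C5 :: "real poly \<Rightarrow> real poly \<Rightarrow> real \<Rightarrow> bool" where
  "C5 a b x \<longleftrightarrow>
     (\<forall>i\<in>{0..3}. coeff a i \<ge> 0 \<and> coeff b i \<ge> 0) \<and>
     same_sign {poly (alpha_u a) x, poly (beta_u b) x,
       poly (c_u a b 0) x, poly (c_u a b 1) x, poly (c_u a b 2) x,
       poly (d_u a b 0) x, poly (d_u a b 1) x, poly (d_u a b 2) x,
       poly (lambda1_u a b) x} \<and>
     poly (kappa_u a b) x \<ge> 0 \<and> poly (gamma2_u a b) x \<ge> 0 \<and>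
     F0 a b > 0"

definition E5_i :: "real \<Rightarrow> bool" where
  "E5_i x \<longleftrightarrow> x = 0"

definition E5_ii :: "real poly \<Rightarrow> real poly \<Rightarrow> real \<Rightarrow> bool" where
  "E5_ii a b x \<longleftrightarrow> poly (c_u a b 0) x = 0"

definition E5_iii :: "real poly \<Rightarrow> real poly \<Rightarrow> real \<Rightarrow> bool" where
  "E5_iii a b x \<longleftrightarrow> poly (d_u a b 2) x = 0"

definition E5 :: "real poly \<Rightarrow> real poly \<Rightarrow> real \<Rightarrow> bool" where
  "E5 a b x \<longleftrightarrow> E5_i x \<or> E5_ii a b x \<or> E5_iii a b x"

end

theory Submission
  imports Defs
begin

text \<open>
  Write \<open>c(s) = c\<^sub>0 + c\<^sub>1 s + c\<^sub>2 s\<^sup>2\<close> and \<open>d(s) = d\<^sub>0 + d\<^sub>1 s + d\<^sub>2 s\<^sup>2\<close>.  The Bezoutians are designed so that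
  \<open>(1 + x s) c = \<beta> a - \<alpha> b\<close> and \<open>(1 + x s) d = \<beta> (\<kappa> b - \<beta> s c)\<close>.  Hence removing the resistor
  \<open>\<alpha> / \<beta> = Z(-1/x)\<close> in series, and then the branch \<open>R\<^sub>5 + 1 / (C\<^sub>1 s)\<close> in parallel, leaves the impedance
  \<open>\<kappa> c / d\<close>, which is expanded as a ladder.  All nondegeneracy follows from the sign conditions and
  \<open>\<gamma>\<^sub>1 \<gamma>\<^sub>3 - \<gamma>\<^sub>2\<^sup>2 = \<beta>\<^sup>4 \<kappa> F\<^sub>0\<close>, \<open>\<gamma>\<^sub>1\<^sup>2 d\<^sub>2 + \<beta>\<^sup>4 \<kappa> F\<^sub>0 d\<^sub>0 = \<gamma>\<^sub>2 \<lambda>\<^sub>1\<close>.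

  A network from N14 satisfies C5 at \<open>x = R\<^sub>5 C\<^sub>1\<close>.  The least \<open>x \<ge> 0\<close> at which C5 holds satisfies E5:
  otherwise all the sign conditions are strict, except possibly the one on \<open>\<alpha>\<close>, and
  \<open>\<alpha>' \<beta> - \<alpha> \<beta>' = - \<kappa>\<close> shows that C5 persists to the left of \<open>x\<close>.
\<close>

section \<open>Bezoutians and the resultant\<close>

text \<open>Over a domain the factor \<open>z - w\<close> cancels, so the explicit quotient need
  only be multiplied back. Its entries are sums of 2x2 minors of the coefficient rows.\<close>

lemma bezout_poly_cubic:
  fixes q p :: "'a::idom_divide poly"
  assumes "q = [:q0, q1, q2, q3:]" and "p = [:p0, p1, p2, p3:]"
  shows "bezout_poly q p =
    [:[:q1 * p0 - p1 * q0, q2 * p0 - p2 * q0, q3 * p0 - p3 * q0:],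
      [:q2 * p0 - p2 * q0, q3 * p0 - p3 * q0 + q2 * p1 - p2 * q1, q3 * p1 - p3 * q1:],
      [:q3 * p0 - p3 * q0, q3 * p1 - p3 * q1, q3 * p2 - p3 * q2:]:]" (is "_ = ?B")
proof -
  have "[:[:0, -1:], 1:] * bezout_poly q p = [:[:0, -1:], 1:] * ?B"
    unfolding bezout_poly_mult assms lift_poly_def
    by (simp add: map_poly_pCons algebra_simps)
  thus ?thesis
    by (simp only: mult_cancel_left) simp
qed

text \<open>The coefficients may be polynomials in \<open>u\<close>, since \<open>d_u\<close> uses
  \<open>c_s\<close> as second argument. Values at a real \<open>x\<close> are enough for the
  identities below.\<close>

lemma u_row_bezout_mat:
  fixes q p :: "real poly poly"
  assumes "q = [:q0, q1, q2, q3:]" and "p = [:p0, p1, p2, p3:]"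
  shows "poly ((u_row * bezout_mat q p) $$ (0, 0)) x =
      - x\<^sup>2 * poly (q1 * p0 - p1 * q0) x + x * poly (q2 * p0 - p2 * q0) x - poly (q3 * p0 - p3 * q0) x"
    and "poly ((u_row * bezout_mat q p) $$ (0, 1)) x =
      - x\<^sup>2 * poly (q2 * p0 - p2 * q0) x + x * poly (q3 * p0 - p3 * q0 + q2 * p1 - p2 * q1) x
      - poly (q3 * p1 - p3 * q1) x"
    and "poly ((u_row * bezout_mat q p) $$ (0, 2)) x =
      - x\<^sup>2 * poly (q3 * p0 - p3 * q0) x + x * poly (q3 * p1 - p3 * q1) x - poly (q3 * p2 - p3 * q2) x"
  unfolding u_row_def bezout_mat_def bezout_poly_cubic[OF assms]
  by (simp_all add: mat_of_rows_list_def scalar_prod_def numeral_3_eq_3 numeral_2_eq_2 algebra_simps)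

section \<open>Determinants of lists of rows by Laplace expansion\<close>

definition rows_det :: "'a::comm_ring_1 list list \<Rightarrow> 'a" where
  "rows_det rs = det (mat_of_rows_list (length rs) rs)"

definition rows_minor :: "'a::comm_ring_1 list list \<Rightarrow> nat \<Rightarrow> 'a" where
  "rows_minor rs j = rows_det (map (\<lambda>xs. take j xs @ drop (Suc j) xs) rs)"

text \<open>Nested subtraction yields the cofactor signs while a row is unfolded entry by entry;
  \<open>k\<close> is the column of the first entry.\<close>

fun alternating_sum :: "(nat \<Rightarrow> 'a::comm_ring_1) \<Rightarrow> nat \<Rightarrow> 'a list \<Rightarrow> 'a" where
  "alternating_sum f k [] = 0"
| "alternating_sum f k (x # xs) = x * f k - alternating_sum f (Suc k) xs"

text \<open>Skips a zero entry without evaluating its minor; the matrix of \<open>F0\<close> has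
  many zeros.\<close>

lemma alternating_sum_0: "alternating_sum f k (0 # xs) = - alternating_sum f (Suc k) xs"
  by simp

lemma alternating_sum_eq: "alternating_sum f k xs = (\<Sum>j<length xs. (- 1) ^ j * xs ! j * f (k + j))"
  by (induction xs arbitrary: k)
    (simp_all add: sum.lessThan_Suc_shift sum_negf del: sum.lessThan_Suc)

lemma rows_det_Nil: "rows_det [] = 1"
  by (simp add: rows_det_def mat_of_rows_list_def)

text \<open>Laplace expansion along the first row: deleting row 0 and column \<open>j\<close> leaves
  the list in \<open>rows_minor\<close>.\<close>

lemma rows_det_Cons:
  assumes "length r = Suc (length rs)" and "\<forall>xs\<in>set rs. length xs = Suc (length rs)"
  shows "rows_det (r # rs) = alternating_sum (rows_minor rs) 0 r"
proof -
  let ?n = "length rs"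
  let ?A = "mat_of_rows_list (Suc ?n) (r # rs)"
  let ?del = "\<lambda>j. map (\<lambda>xs. take j xs @ drop (Suc j) xs) rs"
  have A: "?A \<in> carrier_mat (Suc ?n) (Suc ?n)" by (simp add: mat_of_rows_list_def)
  have del: "mat_delete ?A 0 j = mat_of_rows_list ?n (?del j)" if "j < Suc ?n" for j
  proof (rule eq_matI)
    fix i k
    assume "i < dim_row (mat_of_rows_list ?n (?del j))"
      and "k < dim_col (mat_of_rows_list ?n (?del j))"
    hence i: "i < ?n" and k: "k < ?n" by (simp_all add: mat_of_rows_list_def)
    have "length (rs ! i) = Suc ?n" using assms(2) i by simp
    thus "mat_delete ?A 0 j $$ (i, k) = mat_of_rows_list ?n (?del j) $$ (i, k)"
      using i k that by (simp add: mat_delete_def mat_of_rows_list_def nth_append)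
  qed (simp_all add: mat_delete_def mat_of_rows_list_def)
  have "det ?A = (\<Sum>j<Suc ?n. ?A $$ (0, j) * cofactor ?A 0 j)"
    by (rule laplace_expansion_row[OF A]) simp
  also have "\<dots> = (\<Sum>j<Suc ?n. (- 1) ^ j * r ! j * rows_minor rs j)"
  proof (rule sum.cong)
    fix j assume "j \<in> {..<Suc ?n}"
    hence j: "j < Suc ?n" by simp
    have "?A $$ (0, j) = r ! j"
      using j by (simp add: mat_of_rows_list_def)
    thus "?A $$ (0, j) * cofactor ?A 0 j = (- 1) ^ j * r ! j * rows_minor rs j"
      by (simp add: cofactor_def del[OF j] rows_minor_def rows_det_def)
  qed simp
  finally show ?thesis
    by (simp only: alternating_sum_eq rows_det_def assms(1) list.size add_0 add_Suc_right add_0_right)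
qed

text \<open>The right-hand side is minus the determinant of the 3x3 Bezout matrix of
  \<open>a\<close> and \<open>b\<close>.\<close>

lemma F0_eq:
  defines "m \<equiv> \<lambda>a b k l. coeff a k * coeff b l - coeff b k * coeff a l"
  shows "F0 a b =
    m a b 1 0 * ((m a b 3 1)\<^sup>2 - (m a b 3 0 + m a b 2 1) * m a b 3 2)
    + m a b 2 0 * (m a b 2 0 * m a b 3 2 - m a b 3 1 * m a b 3 0)
    + m a b 3 0 * ((m a b 3 0 + m a b 2 1) * m a b 3 0 - m a b 2 0 * m a b 3 1)"
proof -
  have *: "F0 a b = rows_det
      [[coeff b 3, coeff b 2, coeff b 1, coeff b 0, 0, 0],
       [coeff a 3, coeff a 2, coeff a 1, coeff a 0, 0, 0],
       [0, coeff b 3, coeff b 2, coeff b 1, coeff b 0, 0],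
       [0, coeff a 3, coeff a 2, coeff a 1, coeff a 0, 0],
       [0, 0, coeff b 3, coeff b 2, coeff b 1, coeff b 0],
       [0, 0, coeff a 3, coeff a 2, coeff a 1, coeff a 0]]"
    unfolding F0_def Let_def rows_det_def by (simp add: eval_nat_numeral)
  show ?thesis
    unfolding * m_def
    by (simp add: rows_det_Nil rows_det_Cons rows_minor_def alternating_sum_0)
      (simp add: algebra_simps power2_eq_square)
qed

section \<open>Identities between the polynomials\<close>

lemma cubic_poly_eq:
  fixes p :: "'a::zero poly"
  assumes "degree p \<le> 3"
  shows "p = [:coeff p 0, coeff p 1, coeff p 2, coeff p 3:]"
proof (rule poly_eqI)
  fix n
  consider "n = 0" | "n = 1" | "n = 2" | "n = 3" | k where "n = Suc (Suc (Suc (Suc k)))"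
    by (metis One_nat_def Suc_1 not0_implies_Suc numeral_3_eq_3)
  thus "coeff p n = coeff [:coeff p 0, coeff p 1, coeff p 2, coeff p 3:] n"
    using assms by cases (simp_all add: coeff_eq_0 numeral_2_eq_2 numeral_3_eq_3)
qed

locale cubic_pair =
  fixes a b :: "real poly"
  assumes degree_a: "degree a \<le> 3" and degree_b: "degree b \<le> 3"
begin

abbreviation "al x \<equiv> poly (alpha_u a) x"
abbreviation "be x \<equiv> poly (beta_u b) x"
abbreviation "ka x \<equiv> poly (kappa_u a b) x"
abbreviation "c k x \<equiv> poly (c_u a b k) x"
abbreviation "d k x \<equiv> poly (d_u a b k) x"
abbreviation "g1 x \<equiv> poly (gamma1_u a b) x"
abbreviation "g2 x \<equiv> poly (gamma2_u a b) x"
abbreviation "g3 x \<equiv> poly (gamma3_u a b) x"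
abbreviation "lam x \<equiv> poly (lambda1_u a b) x"

lemma lift_cubic:
  assumes "degree p \<le> 3"
  shows "lift_poly p = [:[:coeff p 0:], [:coeff p 1:], [:coeff p 2:], [:coeff p 3:]:]"
  by (subst cubic_poly_eq[OF assms]) (simp add: lift_poly_def map_poly_pCons)

lemma alpha_eq: "al x = coeff a 3 - coeff a 2 * x + coeff a 1 * x\<^sup>2 - coeff a 0 * x ^ 3"
  by (simp add: alpha_u_def algebra_simps power2_eq_square power3_eq_cube)

lemma beta_eq: "be x = coeff b 3 - coeff b 2 * x + coeff b 1 * x\<^sup>2 - coeff b 0 * x ^ 3"
  by (simp add: beta_u_def algebra_simps power2_eq_square power3_eq_cube)

lemma kappa_eq: "ka x = c 0 x * x\<^sup>2 - c 1 x * x + c 2 x"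
  by (simp add: kappa_u_def algebra_simps power2_eq_square)

lemmas c_explicit =
  u_row_bezout_mat[OF lift_cubic[OF degree_a] lift_cubic[OF degree_b], folded c_u_def]

text \<open>Coefficientwise, \<open>(1 + x s) (c\<^sub>0 + c\<^sub>1 s + c\<^sub>2 s\<^sup>2) = \<beta> a - \<alpha> b\<close>.\<close>

lemma c_relations:
  "c 0 x = be x * coeff a 0 - al x * coeff b 0"
  "c 1 x + x * c 0 x = be x * coeff a 1 - al x * coeff b 1"
  "c 2 x + x * c 1 x = be x * coeff a 2 - al x * coeff b 2"
  "x * c 2 x = be x * coeff a 3 - al x * coeff b 3"
  unfolding c_explicit alpha_eq beta_eq
  by (simp_all add: algebra_simps power2_eq_square power3_eq_cube)

text \<open>Coefficientwise, \<open>(1 + x s) (d\<^sub>0 + d\<^sub>1 s + d\<^sub>2 s\<^sup>2) = \<beta> (\<kappa> b - \<beta> s (c\<^sub>0 + c\<^sub>1 s + c\<^sub>2 s\<^sup>2))\<close>.\<close>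

lemma d_relations:
  "d 0 x = be x * (ka x * coeff b 0)"
  "d 1 x + x * d 0 x = be x * (ka x * coeff b 1 - be x * c 0 x)"
  "d 2 x + x * d 1 x = be x * (ka x * coeff b 2 - be x * c 1 x)"
  "x * d 2 x = be x * (ka x * coeff b 3 - be x * c 2 x)"
  unfolding d_u_def poly_mult u_row_bezout_mat[OF lift_cubic[OF degree_b] c_s_def]
    kappa_eq beta_eq
  by (simp_all add: algebra_simps power2_eq_square power3_eq_cube)

lemma gamma_eq:
  "g1 x = c 1 x * d 0 x - c 0 x * d 1 x"
  "g2 x = c 2 x * d 0 x - c 0 x * d 2 x"
  "g3 x = c 2 x * d 1 x - c 1 x * d 2 x"
  "lam x = d 1 x * g1 x - d 0 x * g2 x"
  by (simp_all add: gamma1_u_def gamma2_u_def gamma3_u_def lambda1_u_def)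

text \<open>For \<open>x \<noteq> 0\<close>, up to sign and powers of \<open>x\<close>,
  \<open>c(s)\<close> is the Bezoutian with one variable set to \<open>-1/x\<close>, and \<kappa>
  sets the other one there too. On the diagonal a Bezoutian is a Wronskian.\<close>

lemma wronskian_alpha_beta:
  "poly (pderiv (alpha_u a)) x * be x - al x * poly (pderiv (beta_u b)) x = - ka x"
  unfolding kappa_eq c_explicit
  by (simp add: alpha_u_def beta_u_def pderiv_pCons algebra_simps power2_eq_square)

end

text \<open>Two evaluations of the resultant of the pair
  \<open>\<beta> a - \<alpha> b = (1 + x s) c\<close> and
  \<open>\<beta> \<kappa> b = (1 + x s) d + \<beta>\<^sup>2 s c\<close>: as a linear transform of
  \<open>a\<close> and \<open>b\<close> with determinant \<open>\<beta>\<^sup>2 \<kappa>\<close>,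
  and in terms of \<open>c\<close> and \<open>d\<close>, whose resultant is
  \<open>g2\<^sup>2 - g1 * g3\<close>.\<close>

lemma resultant_descent:
  fixes x \<beta> \<alpha> :: real
  assumes \<kappa>: "\<kappa> = c0 * x\<^sup>2 - c1 * x + c2"
    and A: "c0 = \<beta> * a0 - \<alpha> * b0" "c1 + x * c0 = \<beta> * a1 - \<alpha> * b1"
      "c2 + x * c1 = \<beta> * a2 - \<alpha> * b2" "x * c2 = \<beta> * a3 - \<alpha> * b3"
    and D: "d0 = \<beta> * (\<kappa> * b0)" "d1 + x * d0 = \<beta> * (\<kappa> * b1 - \<beta> * c0)"
      "d2 + x * d1 = \<beta> * (\<kappa> * b2 - \<beta> * c1)" "x * d2 = \<beta> * (\<kappa> * b3 - \<beta> * c2)"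
  defines "m10 \<equiv> a1 * b0 - b1 * a0" and "m20 \<equiv> a2 * b0 - b2 * a0" and "m30 \<equiv> a3 * b0 - b3 * a0"
    and "m21 \<equiv> a2 * b1 - b2 * a1" and "m31 \<equiv> a3 * b1 - b3 * a1" and "m32 \<equiv> a3 * b2 - b3 * a2"
    and "g1 \<equiv> c1 * d0 - c0 * d1" and "g2 \<equiv> c2 * d0 - c0 * d2" and "g3 \<equiv> c2 * d1 - c1 * d2"
  assumes nz: "\<beta> \<noteq> 0" "\<kappa> \<noteq> 0"
  shows "g1 * g3 - g2\<^sup>2 = \<beta> ^ 4 * \<kappa> * (m10 * (m31\<^sup>2 - (m30 + m21) * m32)
    + m20 * (m20 * m32 - m31 * m30) + m30 * ((m30 + m21) * m30 - m20 * m31))"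
proof -
  \<comment> \<open>Together with \<open>c0\<close> and \<open>d0\<close> these are the coefficients
    of the transformed pair.\<close>
  define A1 A2 A3 D1 D2 D3 where "A1 = c1 + x * c0" and "A2 = c2 + x * c1" and "A3 = x * c2"
    and "D1 = d1 + x * d0 + \<beta>\<^sup>2 * c0" and "D2 = d2 + x * d1 + \<beta>\<^sup>2 * c1" and "D3 = x * d2 + \<beta>\<^sup>2 * c2"
  note defs = A1_def A2_def A3_def D1_def D2_def D3_def
  have D': "d0 = \<beta> * \<kappa> * b0" "D1 = \<beta> * \<kappa> * b1" "D2 = \<beta> * \<kappa> * b2" "D3 = \<beta> * \<kappa> * b3"
    using D by (simp_all add: defs algebra_simps power2_eq_square)
  have A': "c0 = \<beta> * a0 - \<alpha> * b0" "A1 = \<beta> * a1 - \<alpha> * b1" "A2 = \<beta> * a2 - \<alpha> * b2" "A3 = \<beta> * a3 - \<alpha> * b3"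
    using A by (simp_all add: defs)
  let ?q = "\<beta>\<^sup>2 * \<kappa>"
  have M: "?q * m10 = A1 * d0 - D1 * c0" "?q * m20 = A2 * d0 - D2 * c0" "?q * m30 = A3 * d0 - D3 * c0"
    "?q * m21 = A2 * D1 - D2 * A1" "?q * m31 = A3 * D1 - D3 * A1" "?q * m32 = A3 * D2 - D3 * A2"
    unfolding D' A' m10_def m20_def m30_def m21_def m31_def m32_def
    by (simp_all add: algebra_simps power2_eq_square)
  let ?F = "\<lambda>m10 m20 m30 m21 m31 m32. m10 * (m31\<^sup>2 - (m30 + m21) * m32)
    + m20 * (m20 * m32 - m31 * m30) + m30 * ((m30 + m21) * m30 - m20 * m31)"
  \<comment> \<open>The resultant is homogeneous of degree three in the minors, and each minor is
    scaled by \<open>?q\<close>.\<close>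
  have "?q ^ 3 * ?F m10 m20 m30 m21 m31 m32
      = ?F (?q * m10) (?q * m20) (?q * m30) (?q * m21) (?q * m31) (?q * m32)"
    by (simp add: algebra_simps power2_eq_square power3_eq_cube)
  also have "\<dots> = \<beta>\<^sup>2 * \<kappa>\<^sup>2 * (g1 * g3 - g2\<^sup>2)"
    unfolding M unfolding defs \<kappa> g1_def g2_def g3_def
    by (simp add: algebra_simps power2_eq_square)
  finally have "\<beta>\<^sup>2 * \<kappa>\<^sup>2 * (\<beta> ^ 4 * \<kappa> * ?F m10 m20 m30 m21 m31 m32) = \<beta>\<^sup>2 * \<kappa>\<^sup>2 * (g1 * g3 - g2\<^sup>2)"
    by (simp add: eval_nat_numeral algebra_simps)
  thus ?thesis using nz by simp
qed

section \<open>Consequences of C5\<close>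

text \<open>If \<beta> or \<kappa> vanished, the relations would equate nonnegative numbers with
  nonpositive ones and force \<open>c = 0\<close>; if \<open>d0\<close> vanished,
  \<open>g1 * g3 - g2\<^sup>2\<close> could not be positive. The rest follows from the identity for
  \<open>g2 * l\<close>. The last two conclusions serve to move \<open>x\<close> to the
  left.\<close>

lemma realization_nondegenerate:
  fixes x \<beta> \<alpha> :: real
  assumes x: "x \<ge> 0"
    and A: "c0 = \<beta> * a0 - \<alpha> * b0" "c1 + x * c0 = \<beta> * a1 - \<alpha> * b1"
      "c2 + x * c1 = \<beta> * a2 - \<alpha> * b2"
    and D: "d0 = \<beta> * (\<kappa> * b0)" "d1 + x * d0 = \<beta> * (\<kappa> * b1 - \<beta> * c0)"
      "d2 + x * d1 = \<beta> * (\<kappa> * b2 - \<beta> * c1)" "x * d2 = \<beta> * (\<kappa> * b3 - \<beta> * c2)"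
    and g: "g1 = c1 * d0 - c0 * d1" "g2 = c2 * d0 - c0 * d2" "g3 = c2 * d1 - c1 * d2"
      "l = d1 * g1 - d0 * g2"
    and nonneg: "\<beta> \<ge> 0" "\<alpha> \<ge> 0" "c0 \<ge> 0" "c1 \<ge> 0" "c2 \<ge> 0" "d0 \<ge> 0" "d1 \<ge> 0" "d2 \<ge> 0" "l \<ge> 0"
      "\<kappa> \<ge> 0" "g2 \<ge> 0" "b0 \<ge> 0" "b1 \<ge> 0" "b2 \<ge> 0"
    and c: "\<not> (c0 = 0 \<and> c1 = 0 \<and> c2 = 0)"
    and res: "\<beta> \<noteq> 0 \<Longrightarrow> \<kappa> \<noteq> 0 \<Longrightarrow> g1 * g3 - g2\<^sup>2 = \<beta> ^ 4 * \<kappa> * F" and F: "F > 0"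
  shows "\<beta> > 0" "\<kappa> > 0" "d0 > 0" "l > 0" "g1 > 0" "d1 > 0"
    and "g1\<^sup>2 * d2 + \<beta> ^ 4 * \<kappa> * F * d0 = g2 * l"
    and "g2 > 0" "c0 > 0 \<Longrightarrow> c1 > 0" "c0 > 0 \<Longrightarrow> d2 > 0 \<Longrightarrow> c2 > 0"
proof -
  have nn: "\<alpha> * b0 \<ge> 0" "\<alpha> * b1 \<ge> 0" "\<alpha> * b2 \<ge> 0" "x * c0 \<ge> 0" "x * c1 \<ge> 0"
    using nonneg x by simp_all
  show \<beta>: "\<beta> > 0"
  proof (rule ccontr)
    assume "\<not> \<beta> > 0"
    hence "\<beta> = 0" using nonneg by simp
    hence "\<beta> * a0 = 0" "\<beta> * a1 = 0" "\<beta> * a2 = 0" by simp_all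
    hence "c0 = 0" "c1 = 0" "c2 = 0" using A nn nonneg by linarith+
    thus False using c by simp
  qed
  show \<kappa>: "\<kappa> > 0"
  proof (rule ccontr)
    assume "\<not> \<kappa> > 0"
    hence k0: "\<kappa> = 0" using nonneg by simp
    have nn': "\<beta> * (\<beta> * c0) \<ge> 0" "\<beta> * (\<beta> * c1) \<ge> 0" "x * d1 \<ge> 0" "x * d0 \<ge> 0"
      "\<beta> * (\<beta> * c2) \<ge> 0" "x * d2 \<ge> 0"
      using nonneg x by simp_all
    have "d1 + x * d0 = - (\<beta> * (\<beta> * c0))" "d2 + x * d1 = - (\<beta> * (\<beta> * c1))"
      "x * d2 = - (\<beta> * (\<beta> * c2))"
      using D(2-4) unfolding k0 by simp_all
    hence "\<beta> * (\<beta> * c0) = 0" "\<beta> * (\<beta> * c1) = 0" "\<beta> * (\<beta> * c2) = 0"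
      using nn' nonneg by linarith+
    thus False using c \<beta> by simp
  qed
  have r: "g1 * g3 - g2\<^sup>2 > 0"
    using res \<beta> \<kappa> F by simp
  show d0: "d0 > 0"
  proof (rule ccontr)
    assume "\<not> d0 > 0"
    hence d0: "d0 = 0" using nonneg by simp
    \<comment> \<open>With \<open>d0 = 0\<close>, \<open>g2 \<ge> 0\<close> forces
      \<open>c0 * d2 = 0\<close>, which removes the only possibly positive term of
      \<open>g1 * g3\<close>.\<close>
    have "c0 * d2 \<ge> 0" using nonneg by simp
    hence "c0 * d2 = 0" using nonneg(11) unfolding g(2) d0 by simp
    hence "g1 * g3 - g2\<^sup>2 = - (c0 * c2 * d1\<^sup>2)"
      unfolding g d0 by (auto simp: power2_eq_square algebra_simps)
    moreover have "c0 * c2 * d1\<^sup>2 \<ge> 0" using nonneg by simp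
    ultimately show False using r by simp
  qed
  \<comment> \<open>This is \<open>g1\<close> times \<open>g1 * d2 - g2 * d1 + g3 * d0 = 0\<close>,
    the expansion of a determinant with rows \<open>c\<close>, \<open>d\<close>, \<open>d\<close>,
    rearranged.\<close>
  have "g1\<^sup>2 * d2 + (g1 * g3 - g2\<^sup>2) * d0 = g2 * l"
    unfolding g by (simp add: algebra_simps power2_eq_square)
  thus id: "g1\<^sup>2 * d2 + \<beta> ^ 4 * \<kappa> * F * d0 = g2 * l"
    using res \<beta> \<kappa> by simp
  have "g1\<^sup>2 * d2 \<ge> 0" using nonneg by simp
  moreover have "\<beta> ^ 4 * \<kappa> * F * d0 > 0" using \<beta> \<kappa> F d0 by simp
  ultimately have "g2 * l > 0" using id by linarith
  thus g2: "g2 > 0" and l: "l > 0"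
    using nonneg by (auto simp: zero_less_mult_iff)
  have "d1 * g1 > 0" using l g(4) mult_pos_pos[OF d0 g2] by linarith
  thus g1: "g1 > 0" and d1: "d1 > 0"
    using nonneg by (auto simp: zero_less_mult_iff)
  show "c1 > 0" if "c0 > 0"
  proof -
    have "c1 * d0 > 0" using g1 g(1) mult_pos_pos[OF that d1] by linarith
    thus ?thesis using d0 by (simp add: zero_less_mult_iff)
  qed
  show "c2 > 0" if "c0 > 0" "d2 > 0"
  proof -
    have "c2 * d0 > 0" using g2 g(2) mult_pos_pos[OF that] by linarith
    thus ?thesis using d0 by (simp add: zero_less_mult_iff)
  qed
qed

section \<open>The set of points at which C5 holds\<close>

context cubic_pair
begin

text \<open>The hypotheses say that the nonzero row \<open>(-x\<^sup>2, x, -1)\<close> annihilates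
  the Bezout matrix, which is therefore singular.\<close>

lemma F0_eq_0:
  assumes "c 0 x = 0" "c 1 x = 0" "c 2 x = 0"
  shows "F0 a b = 0"
proof -
  define m where "m k l = coeff a k * coeff b l - coeff b k * coeff a l" for k l
  have *: "m 3 0 = x * m 2 0 - x\<^sup>2 * m 1 0" "m 3 1 = x * (m 3 0 + m 2 1) - x\<^sup>2 * m 2 0"
      "m 3 2 = x * m 3 1 - x\<^sup>2 * m 3 0"
    using assms unfolding c_explicit m_def by (simp_all add: algebra_simps)
  show ?thesis
    unfolding F0_eq m_def[symmetric] *(3) *(2) *(1)
    by (simp add: algebra_simps power2_eq_square)
qed

lemma gamma_resultant:
  assumes "be x \<noteq> 0" "ka x \<noteq> 0"
  shows "g1 x * g3 x - (g2 x)\<^sup>2 = be x ^ 4 * ka x * F0 a b"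
  unfolding gamma_eq F0_eq
  by (rule resultant_descent[OF kappa_eq c_relations d_relations assms])

text \<open>With \<sigma> equal to 1 or -1, each case of \<open>same_sign\<close> becomes a
  conjunction of weak polynomial inequalities, hence a closed condition.\<close>

definition signed :: "real \<Rightarrow> real \<Rightarrow> bool" where
  "signed \<sigma> x \<longleftrightarrow> \<sigma> * al x \<ge> 0 \<and> \<sigma> * be x \<ge> 0 \<and>
     \<sigma> * c 0 x \<ge> 0 \<and> \<sigma> * c 1 x \<ge> 0 \<and> \<sigma> * c 2 x \<ge> 0 \<and>
     \<sigma> * d 0 x \<ge> 0 \<and> \<sigma> * d 1 x \<ge> 0 \<and> \<sigma> * d 2 x \<ge> 0 \<and> \<sigma> * lam x \<ge> 0 \<and>
     ka x \<ge> 0 \<and> g2 x \<ge> 0"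

text \<open>Separates the conditions independent of \<open>x\<close> from those that move with
  \<open>x\<close>.\<close>

lemma C5_iff:
  "C5 a b x \<longleftrightarrow> (\<forall>i\<in>{0..3}. coeff a i \<ge> 0 \<and> coeff b i \<ge> 0) \<and> F0 a b > 0 \<and>
     (signed 1 x \<or> signed (- 1) x)"
  unfolding C5_def same_sign_def signed_def by auto

text \<open>\<open>realization_nondegenerate\<close> is applied to \<sigma> times \<alpha>, \<beta>,
  \<open>c\<close>, \<open>d\<close> and \<lambda>, with \<kappa> and the \<gamma> values unchanged;
  surplus factors \<sigma> cancel in pairs.\<close>

lemma C5_strict:
  assumes C5: "C5 a b x" and x: "x \<ge> 0"
  obtains \<sigma> :: real where "\<sigma> = 1 \<or> \<sigma> = - 1" "signed \<sigma> x"
    "\<sigma> * be x > 0" "ka x > 0" "\<sigma> * d 0 x > 0" "\<sigma> * lam x > 0" "g1 x > 0" "\<sigma> * d 1 x > 0"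
    "g2 x > 0" "(g1 x)\<^sup>2 * d 2 x + be x ^ 4 * ka x * F0 a b * d 0 x = g2 x * lam x"
    "c 0 x \<noteq> 0 \<Longrightarrow> \<sigma> * c 1 x > 0" "c 0 x \<noteq> 0 \<Longrightarrow> d 2 x \<noteq> 0 \<Longrightarrow> \<sigma> * c 2 x > 0"
proof -
  from C5 obtain \<sigma> :: real where \<sigma>: "\<sigma> = 1 \<or> \<sigma> = - 1" and s: "signed \<sigma> x"
    unfolding C5_iff by blast
  have F: "F0 a b > 0" and coeffs: "coeff b 0 \<ge> 0" "coeff b 1 \<ge> 0" "coeff b 2 \<ge> 0"
    using C5 unfolding C5_iff by auto
  have sq: "\<sigma> * y * (\<sigma> * z) = y * z" for y z using \<sigma> by auto
  have ne: "\<not> (\<sigma> * c 0 x = 0 \<and> \<sigma> * c 1 x = 0 \<and> \<sigma> * c 2 x = 0)"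
    using F0_eq_0 F \<sigma> by auto
  have res: "\<sigma> * be x \<noteq> 0 \<Longrightarrow> ka x \<noteq> 0 \<Longrightarrow> g1 x * (g3 x) - (g2 x)\<^sup>2 = (\<sigma> * be x) ^ 4 * ka x * F0 a b"
    using gamma_resultant[of x] \<sigma> by auto
  have A1: "\<sigma> * c 0 x = \<sigma> * be x * coeff a 0 - \<sigma> * al x * coeff b 0"
    by (simp add: c_relations(1) algebra_simps)
  have A2: "\<sigma> * c 1 x + x * (\<sigma> * c 0 x) = \<sigma> * be x * coeff a 1 - \<sigma> * al x * coeff b 1"
    using arg_cong[OF c_relations(2)[of x], of "(*) \<sigma>"] by (simp add: algebra_simps)
  have A3: "\<sigma> * c 2 x + x * (\<sigma> * c 1 x) = \<sigma> * be x * coeff a 2 - \<sigma> * al x * coeff b 2"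
    using arg_cong[OF c_relations(3)[of x], of "(*) \<sigma>"] by (simp add: algebra_simps)
  have D1: "\<sigma> * d 0 x = \<sigma> * be x * (ka x * coeff b 0)"
    by (simp add: d_relations(1))
  have D2: "\<sigma> * d 1 x + x * (\<sigma> * d 0 x)
      = \<sigma> * be x * (ka x * coeff b 1 - \<sigma> * be x * (\<sigma> * c 0 x))"
    unfolding sq using arg_cong[OF d_relations(2)[of x], of "(*) \<sigma>"] by (simp add: algebra_simps)
  have D3: "\<sigma> * d 2 x + x * (\<sigma> * d 1 x)
      = \<sigma> * be x * (ka x * coeff b 2 - \<sigma> * be x * (\<sigma> * c 1 x))"
    unfolding sq using arg_cong[OF d_relations(3)[of x], of "(*) \<sigma>"] by (simp add: algebra_simps)
  have D4: "x * (\<sigma> * d 2 x) = \<sigma> * be x * (ka x * coeff b 3 - \<sigma> * be x * (\<sigma> * c 2 x))"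
    unfolding sq using arg_cong[OF d_relations(4)[of x], of "(*) \<sigma>"] by (simp add: algebra_simps)
  have g: "g1 x = \<sigma> * c 1 x * (\<sigma> * d 0 x) - \<sigma> * c 0 x * (\<sigma> * d 1 x)"
    "g2 x = \<sigma> * c 2 x * (\<sigma> * d 0 x) - \<sigma> * c 0 x * (\<sigma> * d 2 x)"
    "g3 x = \<sigma> * c 2 x * (\<sigma> * d 1 x) - \<sigma> * c 1 x * (\<sigma> * d 2 x)"
    "\<sigma> * lam x = \<sigma> * d 1 x * g1 x - \<sigma> * d 0 x * g2 x"
    unfolding sq gamma_eq by (simp_all only: right_diff_distrib mult_ac)
  have nn: "\<sigma> * al x \<ge> 0" "\<sigma> * be x \<ge> 0"
     "\<sigma> * c 0 x \<ge> 0" "\<sigma> * c 1 x \<ge> 0" "\<sigma> * c 2 x \<ge> 0"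
     "\<sigma> * d 0 x \<ge> 0" "\<sigma> * d 1 x \<ge> 0" "\<sigma> * d 2 x \<ge> 0" "\<sigma> * lam x \<ge> 0"
     "ka x \<ge> 0" "g2 x \<ge> 0"
    using s unfolding signed_def by auto
  note nondeg = realization_nondegenerate[OF x A1 A2 A3 D1 D2 D3 D4 g nn(2,1) nn(3-11) coeffs ne res F]
  show thesis
  proof (rule that[OF \<sigma> s nondeg(1-3) nondeg(4-6)])
    show "g2 x > 0" by (rule nondeg(8))
    show "(g1 x)\<^sup>2 * d 2 x + be x ^ 4 * ka x * F0 a b * d 0 x = g2 x * lam x"
      using nondeg(7) \<sigma> by (auto simp: algebra_simps)
    show "\<sigma> * c 1 x > 0" if "c 0 x \<noteq> 0"
      by (rule nondeg(9)) (use that nn(3) \<sigma> in auto)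
    show "\<sigma> * c 2 x > 0" if "c 0 x \<noteq> 0" "d 2 x \<noteq> 0"
      by (rule nondeg(10)) (use that nn(3,8) \<sigma> in auto)
  qed
qed

text \<open>At the left end \<open>x\<close> of an interval on which C5 holds, only \<open>\<alpha>\<close> may vanish without E5 being
  satisfied; but \<open>(\<alpha> \<beta>)' = - \<kappa> < 0\<close> there, so \<open>\<alpha>\<close> has the right sign to the left of \<open>x\<close>.\<close>

lemma C5_left_extension:
  assumes C5: "C5 a b x" and x: "x > 0" and nz: "c 0 x \<noteq> 0" "d 2 x \<noteq> 0"
  shows "\<exists>y. 0 < y \<and> y < x \<and> C5 a b y"
proof -
  obtain \<sigma> :: real where \<sigma>: "\<sigma> = 1 \<or> \<sigma> = - 1" and s: "signed \<sigma> x"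
    and pos: "\<sigma> * be x > 0" "ka x > 0" "\<sigma> * d 0 x > 0" "\<sigma> * lam x > 0" "\<sigma> * d 1 x > 0"
      "g2 x > 0" "\<sigma> * c 1 x > 0" "\<sigma> * c 2 x > 0"
    using C5_strict[OF C5 less_imp_le[OF x]] nz by metis
  have pos': "\<sigma> * c 0 x > 0" "\<sigma> * d 2 x > 0"
    using s nz \<sigma> unfolding signed_def by auto
  have ev: "\<forall>\<^sub>F y in at_left x. \<sigma> * poly p y > 0" if "\<sigma> * poly p x > 0" for p \<sigma>
  proof -
    have "((\<lambda>y. \<sigma> * poly p y) \<longlongrightarrow> \<sigma> * poly p x) (at_left x)"
      by (intro tendsto_intros)
    thus ?thesis using that by (rule order_tendstoD(1))
  qed
  have ev1: "\<forall>\<^sub>F y in at_left x. poly p y > 0" if "poly p x > 0" for p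
    using ev[of 1] that by simp
  have "\<forall>\<^sub>F y in at_left x. \<sigma> * al y \<ge> 0"
  proof (cases "al x = 0")
    case False
    hence "\<sigma> * al x > 0" using s \<sigma> unfolding signed_def by auto
    thus ?thesis using ev eventually_mono by force
  next
    case True
    have "((\<lambda>y. al y * be y) has_real_derivative
        poly (pderiv (alpha_u a)) x * be x + poly (pderiv (beta_u b)) x * al x) (at x)"
      by (rule DERIV_mult; rule poly_DERIV)
    moreover have "poly (pderiv (alpha_u a)) x * be x + poly (pderiv (beta_u b)) x * al x < 0"
      using wronskian_alpha_beta[of x] True pos(2) by simp
    ultimately obtain e where e: "e > 0"
      "\<forall>h>0. h < e \<longrightarrow> al x * be x < al (x - h) * be (x - h)"
      using DERIV_neg_dec_left by blast
    have "\<forall>\<^sub>F y in at_left x. al y * be y > 0"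
    proof -
      have "\<forall>\<^sub>F y in at_left x. y \<in> {x - e<..<x}"
        by (rule eventually_at_left_real) (use e in simp)
      thus ?thesis
      proof eventually_elim
        case (elim y)
        thus ?case using e(2)[rule_format, of "x - y"] True by simp
      qed
    qed
    \<comment> \<open>\<beta> keeps the sign \<sigma> near \<open>x\<close>, so positivity of the
      product fixes the sign of \<alpha>.\<close>
    with ev[OF pos(1)] show ?thesis
    proof eventually_elim
      case (elim y)
      thus ?case using \<sigma> by (auto simp: zero_less_mult_iff)
    qed
  qed
  moreover have "\<forall>\<^sub>F y in at_left x. y \<in> {0<..<x}"
    by (rule eventually_at_left_real) (rule x)
  ultimately have "\<forall>\<^sub>F y in at_left x. 0 < y \<and> y < x \<and> signed \<sigma> y"
    using ev[OF pos(1)] ev1[OF pos(2)] ev[OF pos(3)] ev[OF pos(4)] ev[OF pos(5)]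
      ev1[OF pos(6)] ev[OF pos(7)] ev[OF pos(8)] ev[OF pos'(1)] ev[OF pos'(2)]
    by eventually_elim (simp add: signed_def)
  then obtain y where y: "0 < y" "y < x" "signed \<sigma> y"
    using eventually_happens[of _ "at_left x"] trivial_limit_at_left_real by blast
  have "C5 a b y"
    using C5 \<sigma> y(3) unfolding C5_iff by auto
  thus ?thesis using y by blast
qed

lemma closed_signed: "closed {x. signed \<sigma> x}"
  unfolding signed_def
  by (intro closed_Collect_conj closed_Collect_le continuous_intros)

lemma C5_imp_E5:
  assumes "C5 a b x0" and "x0 \<ge> 0"
  shows "\<exists>x\<ge>0. C5 a b x \<and> E5 a b x"
proof -
  \<comment> \<open>Cutting off at \<open>x0\<close> gives a compact set that still contains
    \<open>x0\<close>, so a least element exists.\<close>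
  let ?S = "{0..x0} \<inter> ({x. signed 1 x} \<union> {x. signed (- 1) x})"
  have S: "x \<in> ?S \<longleftrightarrow> 0 \<le> x \<and> x \<le> x0 \<and> C5 a b x" for x
    using assms(1) by (auto simp: C5_iff)
  have "compact ?S"
    by (intro compact_Int_closed compact_Icc closed_Un closed_signed)
  moreover have "?S \<noteq> {}" using S assms by blast
  ultimately obtain x where x: "x \<in> ?S" "\<And>y. y \<in> ?S \<Longrightarrow> x \<le> y"
    using compact_attains_inf[of ?S] by metis
  have C5: "C5 a b x" "0 \<le> x" "x \<le> x0" using x(1) S by blast+
  moreover have "E5 a b x"
  proof (rule ccontr)
    assume "\<not> E5 a b x"
    hence "x > 0" "c 0 x \<noteq> 0" "d 2 x \<noteq> 0"
      using C5(2) by (auto simp: E5_def E5_i_def E5_ii_def E5_iii_def)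
    then obtain y where "0 < y" "y < x" "C5 a b y"
      using C5_left_extension[OF C5(1)] by blast
    thus False using x(2)[of y] S[of y] C5(3) by auto
  qed
  ultimately show ?thesis by blast
qed

end

section \<open>Impedance of N14\<close>

text \<open>\<open>ladder_num / ladder_den\<close> is the impedance of the branch made of
  \<open>R1\<close>, \<open>L2\<close>, \<open>R2\<close>, \<open>G3\<close>,
  \<open>L1\<close>.\<close>

definition ladder_den :: "real \<Rightarrow> real \<Rightarrow> real \<Rightarrow> real \<Rightarrow> real poly" where
  "ladder_den R2 G3 L1 L2 = [:R2, (R2 * G3 + 1) * L1 + L2, L2 * G3 * L1:]"

definition ladder_num :: "real \<Rightarrow> real \<Rightarrow> real \<Rightarrow> real \<Rightarrow> real \<Rightarrow> real poly" where
  "ladder_num R1 R2 G3 L1 L2 =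
     smult R1 (ladder_den R2 G3 L1 L2) + [:0, L2 * R2, L2 * L1 * (R2 * G3 + 1):]"

text \<open>\<open>P / Q\<close> is the impedance in parallel with the branch of \<open>R5\<close>
  and \<open>C1\<close>, whose own impedance is \<open>(1 + R5 C1 s) / (C1 s)\<close>. Common
  factors are kept.\<close>

definition N14_den :: "real \<Rightarrow> real \<Rightarrow> real poly \<Rightarrow> real poly \<Rightarrow> real poly" where
  "N14_den R5 C1 P Q = [:0, C1:] * P + [:1, R5 * C1:] * Q"

definition N14_num :: "real \<Rightarrow> real \<Rightarrow> real \<Rightarrow> real poly \<Rightarrow> real poly \<Rightarrow> real poly" where
  "N14_num R4 R5 C1 P Q = smult R4 (N14_den R5 C1 P Q) + [:1, R5 * C1:] * P"

lemma series_Fract: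
  assumes "q \<noteq> 0"
  shows "series_imp (Some (rat_const r)) (Some (Fract p q)) = Some (Fract (smult r q + p) q)"
  using assms by (simp add: rat_const_def to_fract_def)

text \<open>Nonzero numerators keep both admittances finite; by the last hypothesis they do not
  cancel, so the result is finite.\<close>

lemma parallel_Fract:
  fixes p q p' q' :: "real poly"
  assumes "p \<noteq> 0" "q \<noteq> 0" "p' \<noteq> 0" "q' \<noteq> 0" "q * p' + q' * p \<noteq> 0"
  shows "parallel_imp (Some (Fract p q)) (Some (Fract p' q'))
    = Some (Fract (p * p') (q * p' + q' * p))"
  using assms by (simp add: parallel_imp_def Zero_fract_def eq_fract mult.commute)

text \<open>At \<open>G = 0\<close> the conductor is \<open>None\<close>, hence the separate case;
  the same fraction then describes the inductor alone.\<close>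

lemma conductor_parallel_inductor:
  assumes "G \<ge> 0" "L > 0"
  shows "impedance (Conductor G \<parallel>\<^sub>p Inductor L) = Some (Fract [:0, L:] [:1, G * L:])"
proof (cases "G = 0")
  case True
  thus ?thesis using assms
    by (simp add: parallel_imp_def rat_const_def rat_s_def to_fract_def Zero_fract_def eq_fract)
next
  case False
  have "impedance (Conductor G) = Some (Fract 1 [:G:])"
    using False by (simp add: rat_const_def to_fract_def Zero_fract_def eq_fract)
  moreover have "impedance (Inductor L) = Some (Fract [:0, L:] 1)"
    by (simp add: rat_const_def rat_s_def to_fract_def)
  moreover have "parallel_imp (Some (Fract 1 [:G:])) (Some (Fract [:0, L:] 1))
      = Some (Fract (1 * [:0, L:]) ([:G:] * [:0, L:] + 1 * 1))"
    by (rule parallel_Fract) (use False assms in \<open>auto simp: one_pCons\<close>)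
  moreover have "[:G:] * [:0, L:] + 1 * 1 = [:1, G * L:]"
    by (simp add: one_pCons)
  ultimately show ?thesis
    by (simp only: impedance.simps(6) mult_1_left)
qed

lemma impedance_N14:
  assumes "R1 \<ge> 0" "R2 > 0" "G3 \<ge> 0" "R4 \<ge> 0" "R5 \<ge> 0" "C1 > 0" "L1 > 0" "L2 > 0"
  defines "P \<equiv> ladder_num R1 R2 G3 L1 L2" and "Q \<equiv> ladder_den R2 G3 L1 L2"
  shows "impedance (N14 R1 R2 G3 R4 R5 C1 L1 L2) = Some (Fract (N14_num R4 R5 C1 P Q) (N14_den R5 C1 P Q))"
    and "N14_den R5 C1 P Q \<noteq> 0"
proof -
  have pos: "R2 * G3 \<ge> 0" "L2 * L1 * (R2 * G3 + 1) > 0" "R2 * G3 * L1 \<ge> 0"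
    using assms(1-8) by (simp_all add: add_nonneg_pos)
  have nz: "P \<noteq> 0" "Q \<noteq> 0"
    unfolding P_def Q_def ladder_num_def ladder_den_def using assms(1-8) pos
    by (auto simp: add_nonneg_eq_0_iff)
  \<comment> \<open>Nonnegative coefficients cannot cancel at \<open>s = 1\<close>, so the
    denominator is a nonzero polynomial.\<close>
  have "poly Q 1 > 0" "poly P 1 > 0"
    unfolding P_def Q_def ladder_num_def ladder_den_def using assms(1-8) pos
    by (simp_all add: add_nonneg_pos add_pos_nonneg)
  hence "poly (N14_den R5 C1 P Q) 1 > 0"
    unfolding N14_den_def using assms(1-8) by (simp add: add_pos_pos add_pos_nonneg)
  thus nz': "N14_den R5 C1 P Q \<noteq> 0" by auto
  let ?X = "[:R2, (R2 * G3 + 1) * L1:]" and ?Y = "[:1, G3 * L1:]"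
  have "impedance (Resistor R2 \<oplus>\<^sub>s (Conductor G3 \<parallel>\<^sub>p Inductor L1)) = Some (Fract ?X ?Y)"
    unfolding impedance.simps(5) conductor_parallel_inductor[OF assms(3,7)] impedance.simps(1)
    by (subst series_Fract) (simp_all add: algebra_simps)
  moreover have "impedance (Inductor L2) = Some (Fract [:0, L2:] 1)"
    by (simp add: rat_const_def rat_s_def to_fract_def)
  moreover have "parallel_imp (Some (Fract [:0, L2:] 1)) (Some (Fract ?X ?Y))
      = Some (Fract ([:0, L2:] * ?X) (1 * ?X + ?Y * [:0, L2:]))"
    by (rule parallel_Fract) (use assms(1-8) in auto)
  moreover have "1 * ?X + ?Y * [:0, L2:] = Q"
    by (simp add: Q_def ladder_den_def algebra_simps)
  ultimately have "impedance (Inductor L2 \<parallel>\<^sub>p (Resistor R2 \<oplus>\<^sub>s (Conductor G3 \<parallel>\<^sub>p Inductor L1)))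
      = Some (Fract ([:0, L2:] * ?X) Q)"
    by simp
  hence "impedance (Resistor R1 \<oplus>\<^sub>s
      (Inductor L2 \<parallel>\<^sub>p (Resistor R2 \<oplus>\<^sub>s (Conductor G3 \<parallel>\<^sub>p Inductor L1))))
      = Some (Fract (smult R1 Q + [:0, L2:] * ?X) Q)"
    using series_Fract[OF nz(2)] by (simp only: impedance.simps)
  moreover have "smult R1 Q + [:0, L2:] * ?X = P"
    by (simp add: P_def Q_def ladder_num_def algebra_simps)
  ultimately have W: "impedance (Resistor R1 \<oplus>\<^sub>s
      (Inductor L2 \<parallel>\<^sub>p (Resistor R2 \<oplus>\<^sub>s (Conductor G3 \<parallel>\<^sub>p Inductor L1)))) = Some (Fract P Q)"
    by simp
  have "impedance (Capacitor C1) = Some (Fract 1 [:0, C1:])"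
    using assms(6) by (simp add: rat_const_def rat_s_def to_fract_def Zero_fract_def eq_fract)
  hence V: "impedance (Resistor R5 \<oplus>\<^sub>s Capacitor C1) = Some (Fract [:1, R5 * C1:] [:0, C1:])"
    using assms(6) series_Fract[of "[:0, C1:]" R5 1] by (simp add: one_pCons)
  have "parallel_imp (Some (Fract [:1, R5 * C1:] [:0, C1:])) (Some (Fract P Q))
      = Some (Fract ([:1, R5 * C1:] * P) ([:0, C1:] * P + Q * [:1, R5 * C1:]))"
    by (rule parallel_Fract) (use nz nz' assms(6) in \<open>auto simp: N14_den_def mult.commute\<close>)
  moreover have "[:0, C1:] * P + Q * [:1, R5 * C1:] = N14_den R5 C1 P Q"
    unfolding N14_den_def by (simp only: mult.commute)
  ultimately show "impedance (N14 R1 R2 G3 R4 R5 C1 L1 L2)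
      = Some (Fract (N14_num R4 R5 C1 P Q) (N14_den R5 C1 P Q))"
    unfolding N14_def impedance.simps(5)[of "Resistor R4"] impedance.simps(6) V W
    using series_Fract[OF nz', of R4] by (simp add: N14_num_def)
qed

lemma N14_den_eq:
  "N14_den R5 C1 [:P0, P1, P2:] [:Q0, Q1, Q2:] =
     [:Q0, Q1 + R5 * C1 * Q0 + C1 * P0, Q2 + R5 * C1 * Q1 + C1 * P1, R5 * C1 * Q2 + C1 * P2:]"
  by (simp add: N14_den_def algebra_simps)

lemma N14_num_eq:
  "N14_num R4 R5 C1 [:P0, P1, P2:] Q =
     smult R4 (N14_den R5 C1 [:P0, P1, P2:] Q) +
     [:P0, P1 + R5 * C1 * P0, P2 + R5 * C1 * P1, R5 * C1 * P2:]"
  by (simp add: N14_num_def algebra_simps)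

section \<open>Networks and C5\<close>

text \<open>The element values expand \<open>\<kappa> c / d\<close> as a ladder. Numerator and
  denominator carry a common factor \<open>m\<close>, fixed by the constant coefficient
  \<open>m * d0 = R2\<close>.\<close>

lemma realized_ladder:
  fixes \<kappa> \<beta> F :: real
  assumes nz: "\<kappa> \<noteq> 0" "\<beta> \<noteq> 0" "F \<noteq> 0" "d0 \<noteq> 0" "l \<noteq> 0"
    and g: "g1 = c1 * d0 - c0 * d1" "g2 = c2 * d0 - c0 * d2" "l = d1 * g1 - d0 * g2"
    and id: "g1\<^sup>2 * d2 + \<beta> ^ 4 * \<kappa> * F * d0 = g2 * l"
  defines "R1 \<equiv> \<kappa> * c0 / d0" and "R2 \<equiv> \<kappa> * g1\<^sup>2 / (d0 * l)" and "G3 \<equiv> d2 * l / (\<kappa>\<^sup>2 * \<beta> ^ 4 * F)"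
    and "L1 \<equiv> \<beta> ^ 4 * \<kappa>\<^sup>2 * g1 * F / l\<^sup>2" and "L2 \<equiv> \<kappa> * g1 / d0\<^sup>2"
    and "m \<equiv> \<kappa> * g1\<^sup>2 / (d0\<^sup>2 * l)"
  shows "ladder_den R2 G3 L1 L2 = [:m * d0, m * d1, m * d2:]"
    and "ladder_num R1 R2 G3 L1 L2 = [:m * \<kappa> * c0, m * \<kappa> * c1, m * \<kappa> * c2:]"
proof -
  \<comment> \<open>The numerator is the left side of \<open>id\<close>, so
    \<open>(R2 * G3 + 1) * L1\<close> reduces to a single quotient.\<close>
  have "R2 * G3 + 1 = (g1\<^sup>2 * d2 + \<beta> ^ 4 * \<kappa> * F * d0) / (d0 * \<kappa> * \<beta> ^ 4 * F)"
    unfolding R2_def G3_def using nz by (simp add: divide_simps power2_eq_square)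
  hence "(R2 * G3 + 1) * L1 = g2 * l / (d0 * \<kappa> * \<beta> ^ 4 * F) * L1"
    unfolding id by simp
  also have "\<dots> = \<kappa> * g1 * g2 / (d0 * l)"
    unfolding L1_def using nz by (simp add: divide_simps power2_eq_square)
  finally have "(R2 * G3 + 1) * L1 = \<kappa> * g1 * g2 / (d0 * l)" .
  note RGL = this
  have m: "m * d0 = R2" "m * \<kappa> * g1 = L2 * R2 * d0" "m * \<kappa> * g2 = L2 * (\<kappa> * g1 * g2 / (d0 * l)) * d0"
    unfolding m_def R2_def L2_def using nz by (simp_all add: divide_simps power2_eq_square)
  have Q1: "(R2 * G3 + 1) * L1 + L2 = m * d1"
  proof -
    have "(R2 * G3 + 1) * L1 + L2 = \<kappa> * g1 * (d0 * g2 + l) / (d0\<^sup>2 * l)"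
      unfolding RGL L2_def using nz by (simp add: divide_simps power2_eq_square algebra_simps)
    also have "d0 * g2 + l = d1 * g1" using g(3) by simp
    finally show ?thesis by (simp add: m_def power2_eq_square mult_ac)
  qed
  have Q2: "L2 * G3 * L1 = m * d2"
    unfolding L2_def G3_def L1_def m_def using nz by (simp add: divide_simps power2_eq_square)
  show Q: "ladder_den R2 G3 L1 L2 = [:m * d0, m * d1, m * d2:]"
    unfolding ladder_den_def Q1 Q2 m(1) by simp
  have R1: "R1 * (m * d0) = m * \<kappa> * c0" "R1 * d0 = \<kappa> * c0" unfolding R1_def using nz by simp_all
  have "R1 * (m * d1) + L2 * R2 = m * \<kappa> * c1"
  proof -
    \<comment> \<open>Multiplication by \<open>d0\<close> clears the denominator of
      \<open>R1\<close> and lets \<open>L2 * R2 * d0\<close> be read as a multiple of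
      \<open>g1\<close>.\<close>
    have "d0 * (R1 * (m * d1) + L2 * R2) = m * d1 * (R1 * d0) + L2 * R2 * d0"
      by (simp add: algebra_simps)
    also have "\<dots> = d0 * (m * \<kappa> * c1)"
      unfolding R1 m(2)[symmetric] g(1) by (simp add: algebra_simps)
    finally show ?thesis using nz by simp
  qed
  moreover have "R1 * (m * d2) + L2 * L1 * (R2 * G3 + 1) = m * \<kappa> * c2"
  proof -
    have "d0 * (R1 * (m * d2) + L2 * L1 * (R2 * G3 + 1))
        = m * d2 * (R1 * d0) + L2 * ((R2 * G3 + 1) * L1) * d0"
      by (simp add: algebra_simps)
    also have "\<dots> = d0 * (m * \<kappa> * c2)"
      unfolding R1 RGL m(3)[symmetric] unfolding g(2) by (simp add: algebra_simps)
    finally show ?thesis using nz by simp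
  qed
  ultimately show "ladder_num R1 R2 G3 L1 L2 = [:m * \<kappa> * c0, m * \<kappa> * c1, m * \<kappa> * c2:]"
    unfolding ladder_num_def Q by (simp add: R1)
qed

text \<open>\<open>R1\<close> enters \<open>P\<close> only through \<open>R1 * Q\<close> and drops
  out of all minors, leaving products of positive parameters. The three quantities are the
  counterparts of \<gamma>2, \<lambda>1 and \<open>F0\<close>.\<close>

lemma ladder_gammas:
  fixes R1 R2 G3 L1 L2 :: real
  assumes "R2 > 0" "G3 \<ge> 0" "L1 > 0" "L2 > 0"
    and Q: "Q0 = R2" "Q1 = (R2 * G3 + 1) * L1 + L2" "Q2 = L2 * G3 * L1"
    and P: "P0 = R1 * Q0" "P1 = R1 * Q1 + L2 * R2" "P2 = R1 * Q2 + L2 * L1 * (R2 * G3 + 1)"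
  defines "g1 \<equiv> P1 * Q0 - P0 * Q1" and "g2 \<equiv> P2 * Q0 - P0 * Q2" and "g3 \<equiv> P2 * Q1 - P1 * Q2"
  shows "g2 > 0" "Q1 * g1 - Q0 * g2 > 0" "g1 * g3 - g2\<^sup>2 > 0"
proof -
  have pos: "R2 * G3 + 1 > 0" using assms(1-4) by (simp add: add_nonneg_pos)
  have g2: "g2 = L2 * L1 * (R2 * G3 + 1) * R2"
    unfolding g2_def P Q by (simp add: algebra_simps)
  thus "g2 > 0" using assms(1-4) pos by simp
  have "Q1 * g1 - Q0 * g2 = L2\<^sup>2 * R2\<^sup>2"
    unfolding g1_def g2_def P Q by (simp add: algebra_simps power2_eq_square)
  thus "Q1 * g1 - Q0 * g2 > 0" using assms(1-4) by simp
  have "g1 * g3 - g2\<^sup>2 = L2 ^ 3 * R2\<^sup>2 * L1"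
    unfolding g1_def g2_def g3_def P Q by (simp add: algebra_simps power2_eq_square power3_eq_cube)
  thus "g1 * g3 - g2\<^sup>2 > 0" using assms(1-4) by simp
qed

context cubic_pair
begin

text \<open>At \<open>x = R5 * C1\<close> the factor \<open>1 + x s\<close> is the numerator of the
  branch of \<open>R5\<close> and \<open>C1\<close>, so removing \<open>R4\<close> and that branch
  recovers \<open>P\<close> and \<open>Q\<close>. The relations are triangular and are solved one
  coefficient at a time.\<close>

lemma N14_polynomials:
  assumes P: "P = [:P0, P1, P2:]" and Q: "Q = [:Q0, Q1, Q2:]"
    and a: "a = smult t (N14_num R4 R5 C1 P Q)" and b: "b = smult t (N14_den R5 C1 P Q)"
  defines "x \<equiv> R5 * C1" and "p \<equiv> P0 * (R5 * C1)\<^sup>2 - P1 * (R5 * C1) + P2"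
  shows "al x = R4 * be x" "be x = t * C1 * p" "ka x = be x * t * p"
    and "c 0 x = be x * t * P0" "c 1 x = be x * t * P1" "c 2 x = be x * t * P2"
    and "d 0 x = be x * ka x * t * Q0" "d 1 x = be x * ka x * t * Q1" "d 2 x = be x * ka x * t * Q2"
proof -
  have B: "coeff b 0 = t * Q0" "coeff b 1 = t * (Q1 + x * Q0 + C1 * P0)"
    "coeff b 2 = t * (Q2 + x * Q1 + C1 * P1)" "coeff b 3 = t * (x * Q2 + C1 * P2)"
    unfolding b P Q N14_den_eq x_def by (simp_all add: numeral_2_eq_2 numeral_3_eq_3)
  have A: "coeff a 0 = R4 * coeff b 0 + t * P0" "coeff a 1 = R4 * coeff b 1 + t * (P1 + x * P0)"
    "coeff a 2 = R4 * coeff b 2 + t * (P2 + x * P1)" "coeff a 3 = R4 * coeff b 3 + t * (x * P2)"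
    unfolding a b P Q N14_num_eq N14_den_eq x_def
    by (simp_all add: numeral_2_eq_2 numeral_3_eq_3 algebra_simps)
  show be: "be x = t * C1 * p"
    unfolding beta_eq B p_def x_def[symmetric]
    by (simp add: algebra_simps power2_eq_square power3_eq_cube)
  show al: "al x = R4 * be x"
    unfolding alpha_eq beta_eq A by (simp add: algebra_simps power2_eq_square power3_eq_cube)
  \<comment> \<open>Subtracting \<alpha> times \<open>b\<close> removes the contribution of
    \<open>R4\<close>.\<close>
  have "be x * (R4 * y + z) - al x * y = be x * z" for y z
    unfolding al by (simp add: algebra_simps)
  note c_rel = c_relations[of x, unfolded A this]
  show c0: "c 0 x = be x * t * P0" using c_rel(1) by simp
  show c1: "c 1 x = be x * t * P1" using c_rel(2) unfolding c0 by (simp add: algebra_simps)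
  show c2: "c 2 x = be x * t * P2" using c_rel(3) unfolding c1 by (simp add: algebra_simps)
  show ka: "ka x = be x * t * p"
    unfolding kappa_eq c0 c1 c2 p_def x_def[symmetric] by (simp add: algebra_simps)
  \<comment> \<open>This makes \<open>\<beta> s c\<close> cancel the capacitor term
    \<open>C1 s P\<close> inside \<open>\<kappa> b\<close>.\<close>
  have kaC: "ka x * C1 = be x * be x" unfolding ka by (simp add: be)
  have "be x * (ka x * (t * (y + C1 * z)) - be x * (be x * t * z)) = be x * ka x * t * y" for y z
  proof -
    have "be x * (ka x * (t * (y + C1 * z)) - be x * (be x * t * z))
        = be x * ka x * t * y + be x * t * z * (ka x * C1 - be x * be x)"
      by (simp add: algebra_simps)
    thus ?thesis by (simp add: kaC)
  qed
  note d_rel = d_relations[of x, unfolded B c0 c1 c2 this]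
  show d0: "d 0 x = be x * ka x * t * Q0" using d_rel(1) by simp
  show d1: "d 1 x = be x * ka x * t * Q1" using d_rel(2) unfolding d0 by (simp add: algebra_simps)
  show d2: "d 2 x = be x * ka x * t * Q2" using d_rel(3) unfolding d1 by (simp add: algebra_simps)
qed

text \<open>For \<open>x \<noteq> 0\<close> the values are \<open>- x ^ 3\<close> times those of
  \<open>a\<close> and \<open>b\<close> at \<open>-1/x\<close>, which coprimality keeps from
  vanishing together; at \<open>x = 0\<close> they are the cubic coefficients.\<close>

lemma alpha_beta_not_both_0:
  assumes "coprime a b" "coeff a 3 \<noteq> 0 \<or> coeff b 3 \<noteq> 0"
  shows "al x \<noteq> 0 \<or> be x \<noteq> 0"
proof (rule ccontr)
  assume "\<not> ?thesis"
  hence 0: "al x = 0" "be x = 0" by auto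
  show False
  proof (cases "x = 0")
    case True
    thus False using 0 assms(2) by (simp add: alpha_eq beta_eq)
  next
    case False
    have "x ^ 3 * poly a (- 1 / x) = - al x"
      unfolding alpha_eq by (subst (1) cubic_poly_eq[OF degree_a])
        (use False in \<open>simp add: field_simps power2_eq_square power3_eq_cube\<close>)
    moreover have "x ^ 3 * poly b (- 1 / x) = - be x"
      unfolding beta_eq by (subst (1) cubic_poly_eq[OF degree_b])
        (use False in \<open>simp add: field_simps power2_eq_square power3_eq_cube\<close>)
    ultimately have "poly a (- 1 / x) = 0" "poly b (- 1 / x) = 0"
      using 0 False by simp_all
    thus False using assms(1) coprime_poly_0 by blast
  qed
qed

text \<open>Every entry of the sign list is \<beta> times a nonnegative number, so the sign of
  \<beta> is the common sign.\<close>

lemma N14_imp_C5: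
  assumes cop: "coprime a b" and lead: "coeff a 3 \<noteq> 0 \<or> coeff b 3 \<noteq> 0"
    and params: "R1 \<ge> 0" "R2 > 0" "G3 \<ge> 0" "R4 \<ge> 0" "R5 \<ge> 0" "C1 > 0" "L1 > 0" "L2 > 0"
    and t: "t > 0"
  defines "P \<equiv> ladder_num R1 R2 G3 L1 L2" and "Q \<equiv> ladder_den R2 G3 L1 L2"
  assumes a: "a = smult t (N14_num R4 R5 C1 P Q)" and b: "b = smult t (N14_den R5 C1 P Q)"
  shows "C5 a b (R5 * C1)"
proof -
  define x where "x = R5 * C1"
  define Q0 where "Q0 = R2"
  define Q1 where "Q1 = (R2 * G3 + 1) * L1 + L2"
  define Q2 where "Q2 = L2 * G3 * L1"
  define P0 where "P0 = R1 * Q0"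
  define P1 where "P1 = R1 * Q1 + L2 * R2"
  define P2 where "P2 = R1 * Q2 + L2 * L1 * (R2 * G3 + 1)"
  note defs = Q0_def Q1_def Q2_def P0_def P1_def P2_def
  have Q: "Q = [:Q0, Q1, Q2:]" unfolding Q_def ladder_den_def defs ..
  have P: "P = [:P0, P1, P2:]"
    unfolding P_def ladder_num_def Q_def[symmetric] Q by (simp add: P0_def P1_def P2_def)
  note poly_eqs = N14_polynomials[OF P Q a b, folded x_def]
  note G = ladder_gammas[OF params(2,3,7,8) defs]
  have nn: "P0 \<ge> 0" "P1 \<ge> 0" "P2 \<ge> 0" "Q0 \<ge> 0" "Q1 \<ge> 0" "Q2 \<ge> 0" "x \<ge> 0"
    unfolding defs x_def using params by simp_all
  have B: "coeff b i \<ge> 0" for i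
    unfolding b P Q N14_den_eq x_def[symmetric] using nn params t
    by (auto simp: coeff_pCons split: nat.splits)
  have A: "coeff a i \<ge> 0" for i
  proof -
    have "a = smult R4 b + smult t [:P0, P1 + x * P0, P2 + x * P1, x * P2:]"
      unfolding a b P N14_num_eq x_def by (simp add: smult_add_right mult_ac)
    thus ?thesis using nn B[of i] params t
      by (auto simp: coeff_pCons split: nat.splits)
  qed
  \<comment> \<open>Since \<alpha> is \<open>R4\<close> times \<beta>, a zero of \<beta> would be a
    common zero.\<close>
  have be: "be x \<noteq> 0"
    using alpha_beta_not_both_0[OF cop lead, of x] poly_eqs(1) by auto
  define p where "p = P0 * x\<^sup>2 - P1 * x + P2"
  note poly_eqs = poly_eqs[folded p_def]
  have "p \<noteq> 0" using be poly_eqs(2) by auto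
  have "ka x = t\<^sup>2 * C1 * p\<^sup>2" unfolding poly_eqs(3) poly_eqs(2) by (simp add: power2_eq_square)
  hence ka: "ka x > 0" using t params \<open>p \<noteq> 0\<close> by simp
  \<comment> \<open>\<open>w\<close> is the factor between the \<gamma> values and their
    counterparts for \<open>P\<close> and \<open>Q\<close>.\<close>
  define w where "w = (be x)\<^sup>2 * ka x * t\<^sup>2"
  have w: "w > 0" using be ka t by (simp add: w_def)
  have g: "g1 x = w * (P1 * Q0 - P0 * Q1)" "g2 x = w * (P2 * Q0 - P0 * Q2)"
    "g3 x = w * (P2 * Q1 - P1 * Q2)"
    unfolding gamma_eq poly_eqs(4-9) w_def by (simp_all add: algebra_simps power2_eq_square)
  have lam: "lam x = be x * (ka x * t * w * (Q1 * (P1 * Q0 - P0 * Q1) - Q0 * (P2 * Q0 - P0 * Q2)))"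
    unfolding gamma_eq(4) g poly_eqs(7,8) by (simp add: algebra_simps)
  \<comment> \<open>The sign of \<open>F0\<close> is read off from the resultant of \<open>c\<close>
    and \<open>d\<close>, which is positive up to convention by
    \<open>ladder_gammas\<close>.\<close>
  have "be x ^ 4 * ka x * F0 a b = g1 x * g3 x - (g2 x)\<^sup>2"
    using gamma_resultant[OF be] ka by simp
  also have "\<dots> = w\<^sup>2 * ((P1 * Q0 - P0 * Q1) * (P2 * Q1 - P1 * Q2) - (P2 * Q0 - P0 * Q2)\<^sup>2)"
    unfolding g by (simp add: algebra_simps power2_eq_square)
  also have "\<dots> > 0" using w G(3) by simp
  finally have "be x ^ 4 * ka x * F0 a b > 0" .
  moreover have "be x ^ 4 * ka x > 0" using be ka by simp
  ultimately have F: "F0 a b > 0" by (rule zero_less_mult_pos)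
  define \<sigma> :: real where "\<sigma> = (if be x > 0 then 1 else - 1)"
  have \<sigma>: "\<sigma> = 1 \<or> \<sigma> = - 1" by (simp add: \<sigma>_def)
  have mult: "\<sigma> * (be x * y) \<ge> 0" if "y \<ge> 0" for y
    using that by (auto simp: \<sigma>_def mult_nonpos_nonneg)
  have "signed \<sigma> x"
    unfolding signed_def
  proof (intro conjI)
    show "\<sigma> * be x \<ge> 0" using mult[of 1] by simp
    show "\<sigma> * al x \<ge> 0" using mult[OF params(4)] by (simp add: poly_eqs(1) mult_ac)
    show "\<sigma> * c 0 x \<ge> 0" "\<sigma> * c 1 x \<ge> 0" "\<sigma> * c 2 x \<ge> 0"
      unfolding poly_eqs(4-6) mult.assoc by (rule mult; use nn t in simp)+
    show "\<sigma> * d 0 x \<ge> 0" "\<sigma> * d 1 x \<ge> 0" "\<sigma> * d 2 x \<ge> 0"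
      unfolding poly_eqs(7-9) mult.assoc by (rule mult; use nn t ka in simp)+
    show "\<sigma> * lam x \<ge> 0"
      unfolding lam by (rule mult) (use G(2) w t ka in simp)
    show "ka x \<ge> 0" using ka by simp
    show "g2 x \<ge> 0" unfolding g using w G(1) by simp
  qed
  thus ?thesis unfolding C5_iff x_def[symmetric] using A B F \<sigma> by auto
qed

text \<open>The \<open>c\<close> and \<open>d\<close> relations show that the network numerator and
  denominator are \<open>a\<close> and \<open>b\<close> times the same constant
  \<open>m * be x * ka x\<close>. The element values have the right signs because the quantities of
  sign \<sigma> occur in pairs.\<close>

lemma C5_imp_realization:
  assumes C5: "C5 a b x" and x: "x \<ge> 0" and Z: "Z = Fract a b"
    and params: "R1 = ka x * c 0 x / d 0 x" "R2 = ka x * (g1 x)\<^sup>2 / (d 0 x * lam x)"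
      "G3 = d 2 x * lam x / ((ka x)\<^sup>2 * be x ^ 4 * F0 a b)" "R4 = al x / be x"
      "R5 = ka x * x / (be x)\<^sup>2" "C1 = (be x)\<^sup>2 / ka x"
      "L1 = be x ^ 4 * (ka x)\<^sup>2 * g1 x * F0 a b / (lam x)\<^sup>2" "L2 = ka x * g1 x / (d 0 x)\<^sup>2"
  shows "be x \<noteq> 0" "d 0 x \<noteq> 0" "lam x \<noteq> 0" "ka x > 0" "g1 x > 0"
    and "R1 \<ge> 0" "R2 > 0" "G3 \<ge> 0" "R4 \<ge> 0" "R5 \<ge> 0" "C1 > 0" "L1 > 0" "L2 > 0"
    and "impedance (N14 R1 R2 G3 R4 R5 C1 L1 L2) = Some Z"
proof -
  obtain \<sigma> :: real where \<sigma>: "\<sigma> = 1 \<or> \<sigma> = - 1" and s: "signed \<sigma> x"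
    and pos: "\<sigma> * be x > 0" "ka x > 0" "\<sigma> * d 0 x > 0" "\<sigma> * lam x > 0" "g1 x > 0"
    and id: "(g1 x)\<^sup>2 * d 2 x + be x ^ 4 * ka x * F0 a b * d 0 x = g2 x * lam x"
    using C5_strict[OF C5 x] by metis
  have F: "F0 a b > 0" using C5 by (simp add: C5_iff)
  show nz: "be x \<noteq> 0" "d 0 x \<noteq> 0" "lam x \<noteq> 0" and ka: "ka x > 0" "g1 x > 0"
    using pos by auto
  have nn: "\<sigma> * c 0 x \<ge> 0" "\<sigma> * d 2 x \<ge> 0" "\<sigma> * al x \<ge> 0"
    using s by (simp_all add: signed_def)
  have \<sigma>2: "\<sigma> * y * (\<sigma> * z) = y * z" "\<sigma> * y / (\<sigma> * z) = y / z" for y z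
    using \<sigma> by auto
  have prods: "c 0 x / d 0 x \<ge> 0" "d 0 x * lam x > 0" "d 2 x * lam x \<ge> 0" "al x / be x \<ge> 0"
    using divide_nonneg_pos[OF nn(1) pos(3)] mult_pos_pos[OF pos(3,4)]
      mult_nonneg_nonneg[OF nn(2) less_imp_le[OF pos(4)]] divide_nonneg_pos[OF nn(3) pos(1)]
    unfolding \<sigma>2 by this+
  show p1: "R1 \<ge> 0"
    using mult_nonneg_nonneg[OF less_imp_le[OF ka(1)] prods(1)] by (simp add: params)
  show p2: "R2 > 0"
    unfolding params by (rule divide_pos_pos) (use prods ka in simp_all)
  show p3: "G3 \<ge> 0"
    unfolding params by (rule divide_nonneg_nonneg) (use prods F in simp_all)
  show p4: "R4 \<ge> 0" using prods by (simp add: params)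
  show p5: "R5 \<ge> 0" using x ka by (simp add: params)
  show p6: "C1 > 0" using nz ka by (simp add: params)
  show p7: "L1 > 0" using nz ka F by (simp add: params)
  show p8: "L2 > 0" using nz ka by (simp add: params)
  define m where "m = ka x * (g1 x)\<^sup>2 / ((d 0 x)\<^sup>2 * lam x)"
  have m: "m \<noteq> 0" using nz ka by (simp add: m_def)
  define P where "P = ladder_num R1 R2 G3 L1 L2"
  define Q where "Q = ladder_den R2 G3 L1 L2"
  have PQ: "Q = [:m * d 0 x, m * d 1 x, m * d 2 x:]"
    "P = [:m * ka x * c 0 x, m * ka x * c 1 x, m * ka x * c 2 x:]"
    unfolding P_def Q_def params m_def
    using realized_ladder[OF _ nz(1) _ nz(2,3) gamma_eq(1,2,4) id] ka F by auto
  have R5C1: "R5 * C1 = x" using nz ka by (simp add: params)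
  \<comment> \<open>The capacitor contributes \<open>m \<beta>\<^sup>2 s c\<close>, which completes
    \<open>m (1 + x s) d\<close> to a multiple of \<open>b\<close>.\<close>
  have C1: "C1 * (m * ka x * y) = m * (be x * be x * y)" for y
    using ka by (simp add: params power2_eq_square)
  have d: "d 1 x + x * d 0 x + be x * be x * c 0 x = be x * ka x * coeff b 1"
    "d 2 x + x * d 1 x + be x * be x * c 1 x = be x * ka x * coeff b 2"
    "x * d 2 x + be x * be x * c 2 x = be x * ka x * coeff b 3"
    using d_relations(2-4)[of x] by (simp_all add: algebra_simps)
  let ?D = "N14_den R5 C1 P Q"
  have "?D = smult m [:d 0 x, d 1 x + x * d 0 x + be x * be x * c 0 x,
      d 2 x + x * d 1 x + be x * be x * c 1 x, x * d 2 x + be x * be x * c 2 x:]"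
    unfolding PQ N14_den_eq R5C1 C1 by (simp add: algebra_simps)
  also have "\<dots> = smult (m * be x * ka x) [:coeff b 0, coeff b 1, coeff b 2, coeff b 3:]"
    unfolding d unfolding d_relations(1) by (simp add: mult_ac)
  finally have den: "?D = smult (m * be x * ka x) b"
    unfolding cubic_poly_eq[OF degree_b, symmetric] .
  have smult_b: "smult (al x) b = smult (al x) [:coeff b 0, coeff b 1, coeff b 2, coeff b 3:]"
    unfolding cubic_poly_eq[OF degree_b, symmetric] ..
  have "N14_num R4 R5 C1 P Q = smult R4 ?D + smult (m * ka x) [:c 0 x, c 1 x + x * c 0 x,
      c 2 x + x * c 1 x, x * c 2 x:]"
    unfolding PQ(2) N14_num_eq R5C1 by (simp add: algebra_simps)
  also have "\<dots> = smult (m * ka x) (smult (al x) b + [:c 0 x, c 1 x + x * c 0 x,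
      c 2 x + x * c 1 x, x * c 2 x:])"
    unfolding den using nz by (simp add: params smult_add_right mult_ac)
  also have "smult (al x) b + [:c 0 x, c 1 x + x * c 0 x, c 2 x + x * c 1 x, x * c 2 x:]
      = smult (be x) [:coeff a 0, coeff a 1, coeff a 2, coeff a 3:]"
    unfolding c_relations(2-4) unfolding c_relations(1) smult_b by (simp add: algebra_simps)
  finally have num: "N14_num R4 R5 C1 P Q = smult (m * be x * ka x) a"
    unfolding cubic_poly_eq[OF degree_a, symmetric] by (simp add: mult_ac)
  note imp = impedance_N14[OF p1 p2 p3 p4 p5 p6 p7 p8, folded P_def Q_def]
  have "b \<noteq> 0" using imp(2) den by auto
  hence "Fract (N14_num R4 R5 C1 P Q) ?D = Z"
    using imp(2) by (simp add: Z num den eq_fract)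
  thus "impedance (N14 R1 R2 G3 R4 R5 C1 L1 L2) = Some Z"
    using imp(1) by simp
qed

end

text \<open>Without a \<open>gcd\<close> on \<^typ>\<open>real poly\<close> (only \<open>Field_as_Ring\<close> provides it): the multipliers \<open>r\<close> with
  \<open>b dvd a * r\<close> form an ideal, whose generator \<open>g\<close> divides both \<open>b\<close> and \<open>q\<close>.\<close>

lemma coprime_dvd_multD_poly:
  fixes a b q :: "'a::field poly"
  assumes cop: "coprime a b" and dvd: "b dvd a * q" and b: "b \<noteq> 0"
  shows "b dvd q"
proof -
  let ?I = "\<lambda>r. b dvd a * r"
  define g where "g = arg_min degree (\<lambda>r. ?I r \<and> r \<noteq> 0)"
  have "?I b \<and> b \<noteq> 0" using b by simp
  hence g: "?I g" "g \<noteq> 0"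
    unfolding g_def using arg_min_natI[of "\<lambda>r. ?I r \<and> r \<noteq> 0"] by blast+
  have min: "degree g \<le> degree r" if "?I r" "r \<noteq> 0" for r
    unfolding g_def using that by (intro arg_min_nat_le) simp
  have dvd_g: "g dvd r" if "?I r" for r
  proof (rule ccontr)
    assume "\<not> g dvd r"
    hence nz: "r mod g \<noteq> 0" by (simp add: dvd_eq_mod_eq_0)
    have "a * (r mod g) = a * r - a * g * (r div g)"
      by (simp add: minus_mult_div_eq_mod[symmetric] algebra_simps)
    hence "?I (r mod g)" using that g(1) by simp
    hence "degree g \<le> degree (r mod g)" using min nz by blast
    moreover have "degree (r mod g) < degree g" using degree_mod_less[OF g(2), of r] nz by simp
    ultimately show False by simp
  qed
  obtain s where s: "b = g * s" using dvd_g[of b] by auto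
  \<comment> \<open>\<open>g * s\<close> divides \<open>a * g\<close>; cancelling \<open>g\<close>
    makes \<open>s\<close> a common divisor of \<open>a\<close> and \<open>b\<close>.\<close>
  have "s dvd a" using g s by (simp add: mult.commute[of a])
  hence "is_unit s" using cop s by (meson coprime_common_divisor dvd_triv_right)
  hence "b dvd g" unfolding s by simp
  thus ?thesis using dvd_g[OF dvd] dvd_trans by blast
qed

text \<open>Since \<open>b dvd q\<close>, one polynomial \<open>r\<close> turns \<open>a\<close>,
  \<open>b\<close> into \<open>p\<close>, \<open>q\<close>; as \<open>a\<close> or \<open>b\<close>
  already reaches degree \<open>n\<close>, \<open>r\<close> is constant.\<close>

lemma coprime_Fract_eq:
  fixes a b p q :: "real poly"
  assumes cop: "coprime a b" and deg: "degree p \<le> n" "degree q \<le> n"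
    and lead: "coeff a n \<noteq> 0 \<or> coeff b n \<noteq> 0" and q: "q \<noteq> 0" and b: "b \<noteq> 0"
    and eq: "Fract p q = Fract a b"
  obtains t where "p = smult t a" "q = smult t b"
proof -
  have pq: "p * b = a * q" using eq q b by (simp add: eq_fract)
  have "b dvd a * q" using pq by (metis dvd_triv_right)
  hence "b dvd q" by (rule coprime_dvd_multD_poly[OF cop _ b])
  then obtain r where r: "q = b * r" by blast
  hence pr: "p = a * r" using pq b by simp
  have "r \<noteq> 0" using q r by auto
  have "degree r = 0"
  proof (cases "coeff b n \<noteq> 0")
    case True
    hence "n + degree r \<le> n"
      using deg(2) r \<open>r \<noteq> 0\<close> b le_degree[of b n] by (simp add: degree_mult_eq)
    thus ?thesis by simp
  next
    case False
    hence "coeff a n \<noteq> 0" using lead by simp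
    hence "a \<noteq> 0" "n \<le> degree a" by (auto simp: le_degree)
    hence "n + degree r \<le> n" using deg(1) pr \<open>r \<noteq> 0\<close> by (simp add: degree_mult_eq)
    thus ?thesis by simp
  qed
  then obtain t where "r = [:t:]" by (rule degree_eq_zeroE)
  thus thesis using that[of t] pr r by simp
qed

theorem theorem25:
  fixes a b :: "real poly" and Z :: "real poly fract"
  assumes "degree a \<le> 3" and "degree b \<le> 3"
    and "coprime a b"
    and "coeff a 3 \<noteq> 0 \<or> coeff b 3 \<noteq> 0"
    and "\<exists>i\<in>{0..3}. coeff b i > 0"
    and "Z = Fract a b"
  shows "((\<exists>N\<in>class_N14. impedance N = Some Z) \<longrightarrow> (\<exists>x\<ge>0. C5 a b x \<and> E5 a b x)) \<and>
    (\<forall>x\<ge>0. C5 a b x \<longrightarrow>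
      (let \<alpha> = poly (alpha_u a) x; \<beta> = poly (beta_u b) x; \<kappa> = poly (kappa_u a b) x;
           c0 = poly (c_u a b 0) x; d0 = poly (d_u a b 0) x; d2 = poly (d_u a b 2) x;
           \<gamma>1 = poly (gamma1_u a b) x; lam1 = poly (lambda1_u a b) x;
           R1 = \<kappa> * c0 / d0;
           R2 = \<kappa> * \<gamma>1\<^sup>2 / (d0 * lam1);
           G3 = d2 * lam1 / (\<kappa>\<^sup>2 * \<beta> ^ 4 * F0 a b);
           R4 = \<alpha> / \<beta>;
           R5 = \<kappa> * x / \<beta>\<^sup>2;
           C1 = \<beta>\<^sup>2 / \<kappa>;
           L1 = \<beta> ^ 4 * \<kappa>\<^sup>2 * \<gamma>1 * F0 a b / lam1\<^sup>2;
           L2 = \<kappa> * \<gamma>1 / d0\<^sup>2;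
           N = N14 R1 R2 G3 R4 R5 C1 L1 L2
       in \<beta> \<noteq> 0 \<and> d0 \<noteq> 0 \<and> lam1 \<noteq> 0 \<and> \<kappa> > 0 \<and> \<gamma>1 > 0 \<and>
          N \<in> class_N14 \<and> impedance N = Some Z \<and>
          (E5_i x \<longrightarrow> R5 = 0 \<and> N \<in> class_N30) \<and>
          (E5_ii a b x \<longrightarrow> R1 = 0 \<and> N \<in> class_N28) \<and>
          (E5_iii a b x \<longrightarrow> G3 = 0 \<and> N \<in> class_N29)))"
proof -
  interpret cubic_pair a b by standard (use assms in auto)
  have part1: "\<exists>x\<ge>0. C5 a b x \<and> E5 a b x"
    if N: "N \<in> class_N14" "impedance N = Some Z" for N
  proof -
    obtain R1 R2 G3 R4 R5 C1 L1 L2 where NN: "N = N14 R1 R2 G3 R4 R5 C1 L1 L2"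
      and p: "R1 \<ge> 0" "R2 > 0" "G3 \<ge> 0" "R4 \<ge> 0" "R5 \<ge> 0" "C1 > 0" "L1 > 0" "L2 > 0"
      using N(1) unfolding class_N14_def by blast
    define P where "P = ladder_num R1 R2 G3 L1 L2"
    define Q where "Q = ladder_den R2 G3 L1 L2"
    let ?num = "N14_num R4 R5 C1 P Q" and ?den = "N14_den R5 C1 P Q"
    note imp = impedance_N14[OF p, folded P_def Q_def]
    obtain P0 P1 P2 Q0 Q1 Q2 where PQ: "P = [:P0, P1, P2:]" "Q = [:Q0, Q1, Q2:]"
      and nn: "P0 \<ge> 0" "P1 \<ge> 0" "P2 \<ge> 0" "Q0 \<ge> 0" "Q1 \<ge> 0" "Q2 \<ge> 0"
      using p by (simp add: P_def Q_def ladder_num_def ladder_den_def)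
    have deg: "degree ?den \<le> 3" "degree ?num \<le> 3"
      unfolding PQ N14_num_eq N14_den_eq by simp_all
    have "b \<noteq> 0" using assms(5) by auto
    have "Fract ?num ?den = Fract a b"
      using imp(1) N(2) NN assms(6) by simp
    then obtain t where t: "?num = smult t a" "?den = smult t b"
      using coprime_Fract_eq[OF assms(3) deg(2,1) assms(4) imp(2) \<open>b \<noteq> 0\<close>] by blast
    have "t \<noteq> 0" using t(2) imp(2) by auto
    obtain i where i: "coeff b i > 0" using assms(5) by auto
    have "coeff ?den i \<ge> 0"
      unfolding PQ N14_den_eq using nn p by (auto simp: coeff_pCons split: nat.splits)
    \<comment> \<open>The network denominator has nonnegative coefficients and \<open>b\<close> has
      a positive one, which fixes the sign of \<open>t\<close>.\<close>
    hence "t > 0" using t(2) i \<open>t \<noteq> 0\<close> by (simp add: zero_le_mult_iff)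
    \<comment> \<open>Here \<open>t\<close> scales \<open>a\<close> and \<open>b\<close> to the
      network polynomials, whereas \<open>N14_imp_C5\<close> scales in the other direction, hence
      \<open>1 / t\<close>.\<close>
    have "C5 a b (R5 * C1)"
      by (rule N14_imp_C5[OF assms(3,4) p, of "1 / t", folded P_def Q_def])
        (use \<open>t > 0\<close> t in simp_all)
    thus ?thesis using C5_imp_E5 p by simp
  qed
  let "_ \<and> (\<forall>x\<ge>0. C5 a b x \<longrightarrow> ?realized x)" = ?thesis
  have part2: "?realized x" if x: "x \<ge> 0" "C5 a b x" for x
  proof -
    define R1 where "R1 = ka x * c 0 x / d 0 x"
    define R2 where "R2 = ka x * (g1 x)\<^sup>2 / (d 0 x * lam x)"
    define G3 where "G3 = d 2 x * lam x / ((ka x)\<^sup>2 * be x ^ 4 * F0 a b)"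
    define R4 where "R4 = al x / be x"
    define R5 where "R5 = ka x * x / (be x)\<^sup>2"
    define C1 where "C1 = (be x)\<^sup>2 / ka x"
    define L1 where "L1 = be x ^ 4 * (ka x)\<^sup>2 * g1 x * F0 a b / (lam x)\<^sup>2"
    define L2 where "L2 = ka x * g1 x / (d 0 x)\<^sup>2"
    note defs = R1_def R2_def G3_def R4_def R5_def C1_def L1_def L2_def
    note r = C5_imp_realization[OF x(2,1) assms(6) defs]
    have "R5 = 0" if "E5_i x" using that by (simp add: R5_def E5_i_def)
    moreover have "R1 = 0" if "E5_ii a b x" using that by (simp add: R1_def E5_ii_def)
    moreover have "G3 = 0" if "E5_iii a b x" using that by (simp add: G3_def E5_iii_def)
    moreover have "N14 R1 R2 G3 R4 R5 C1 L1 L2 \<in> class_N14"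
      unfolding class_N14_def using r by blast
    moreover have "N14 R1 R2 G3 R4 R5 C1 L1 L2 \<in> class_N30" if "R5 = 0"
      unfolding class_N30_def that using r by blast
    moreover have "N14 R1 R2 G3 R4 R5 C1 L1 L2 \<in> class_N28" if "R1 = 0"
      unfolding class_N28_def that using r by blast
    moreover have "N14 R1 R2 G3 R4 R5 C1 L1 L2 \<in> class_N29" if "G3 = 0"
      unfolding class_N29_def that using r by blast
    ultimately show ?thesis
      unfolding Let_def defs[symmetric] using r(1-5,14) by blast
  qed
  show ?thesis using part1 part2 by blast
qed

end
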